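(* For all $n$, \[\dim\tilde H_{n-1}(PCP_n^-\ast C_n)=d_n^{BC},\] where $d_n^{BC}$ is the number of elements of the Weyl group of type $BC_n$ (the hyperoctahedral group $\mathfrak S_n[\mathbb Z_2]$ acting by reflections on the $n$-dimensional cross-polytope $CP_n$) that fix no vertex of $CP_n$.
   Context: $PCP_n$ is the poset, ordered by inclusion, of proper faces of the $n$-dimensional cross-polytope $CP_n$ (including the empty face, which is its minimum); $PCP_n^-$ is $PCP_n$ with the empty face removed. $C_n$ is the chain $0<\dots<n-1$. The Rees product of ranked posets is $P\ast Q=\{(p,q): r_P(p)\ge r_Q(q)\}$ with $(p_1,q_1)\le(p_2,q_2)$ iff $p_1\le p_2$, $q_1\le q_2$, $r_P(p_2)-r_P(p_1)\ge r_Q(q_2)-r_Q(q_1)$. $\tilde H_k$ is reduced homology over $\mathbb C$ of the order complex. *)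

theory Defs
  imports "HOL-Analysis.Analysis" "HOL-Algebra.QuotRing" "Jordan_Normal_Form.VS_Connect"
begin

text \<open>
  A poset is given by its reflexive order relation \<open>r\<close>, with ground set \<^term>\<open>Field r\<close>; by
  reflexivity the members of \<^term>\<open>Chains r\<close> are exactly the chains contained in the ground set.
\<close>

text \<open>
  The rank of \<open>x\<close> is the length of the longest chain ending in \<open>x\<close>, i.e. the largest number of
  elements in a chain strictly below \<open>x\<close>. Minimal elements have rank 0. (Meant for posets in
  which these lengths are bounded.)
\<close>
definition poset_rank :: "'a rel \<Rightarrow> 'a \<Rightarrow> nat" where
  "poset_rank r x = Max {card C | C. C \<in> Chains r \<and> finite C \<and> (\<forall>c\<in>C. (c, x) \<in> r \<and> c \<noteq> x)}"

definition rees_product :: "'a rel \<Rightarrow> 'b rel \<Rightarrow> ('a \<times> 'b) rel" where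
  "rees_product P Q =
     {((p1, q1), (p2, q2)).
        poset_rank P p1 \<ge> poset_rank Q q1 \<and> poset_rank P p2 \<ge> poset_rank Q q2 \<and>
        (p1, p2) \<in> P \<and> (q1, q2) \<in> Q \<and>
        int (poset_rank P p2) - int (poset_rank P p1)
          \<ge> int (poset_rank Q q2) - int (poset_rank Q q1)}"

definition chain_poset :: "nat \<Rightarrow> nat rel" where
  "chain_poset n = {(i, j). i \<le> j \<and> j < n}"

definition cross_polytope :: "(real ^ 'n) set" where
  "cross_polytope = convex hull (range (\<lambda>i. axis i 1) \<union> range (\<lambda>i. - axis i 1))"

text \<open>Note that the empty set is a face in the sense of \<^const>\<open>face_of\<close>.\<close>
definition PCP :: "(real ^ 'n) set rel" where
  "PCP = {(F, G). F face_of cross_polytope \<and> F \<noteq> cross_polytope \<and>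
                  G face_of cross_polytope \<and> G \<noteq> cross_polytope \<and> F \<subseteq> G}"

definition PCP_minus :: "(real ^ 'n) set rel" where
  "PCP_minus = Restr PCP (- {{}})"

text \<open>
  Order complex. The \<open>k\<close>-simplices are the chains with \<open>k + 1\<close> elements; the empty chain is
  the unique simplex of dimension -1, so that the chain complex below is the augmented one and
  computes reduced homology. A \<open>k\<close>-chain is a finitely supported complex-valued function on the
  \<open>k\<close>-simplices.
\<close>
definition simplices :: "'a rel \<Rightarrow> int \<Rightarrow> 'a set set" where
  "simplices r k = {c \<in> Chains r. finite c \<and> int (card c) = k + 1}"

definition chain_space :: "'a rel \<Rightarrow> int \<Rightarrow> (complex, 'a set \<Rightarrow> complex) module" where
  "chain_space r k =
     \<lparr>carrier = {f. finite {c. f c \<noteq> 0} \<and> {c. f c \<noteq> 0} \<subseteq> simplices r k},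
      mult = undefined, one = undefined,
      zero = (\<lambda>c. 0), add = (\<lambda>f g c. f c + g c), smult = (\<lambda>a f c. a * f c)\<rparr>"

text \<open>
  Linear extension of \<open>[x\<^sub>0 < \<dots> < x\<^sub>k] \<mapsto> \<Sum>i. (-1)\<^sup>i [x\<^sub>0 < \<dots> < x\<^sub>i\<^sub>-\<^sub>1 < x\<^sub>i\<^sub>+\<^sub>1 < \<dots> < x\<^sub>k]\<close>; the position
  \<open>i\<close> of \<open>x\<close> in the chain \<open>c\<close> is the number of elements of \<open>c\<close> strictly below \<open>x\<close>.
\<close>
definition boundary :: "'a rel \<Rightarrow> ('a set \<Rightarrow> complex) \<Rightarrow> ('a set \<Rightarrow> complex)" where
  "boundary r f = (\<lambda>d. \<Sum>c | f c \<noteq> 0. \<Sum>x | x \<in> c \<and> c - {x} = d.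
     (-1) ^ card {y \<in> c. (y, x) \<in> r \<and> y \<noteq> x} * f c)"

definition cycles :: "'a rel \<Rightarrow> int \<Rightarrow> ('a set \<Rightarrow> complex) set" where
  "cycles r k = {f \<in> carrier (chain_space r k). boundary r f = (\<lambda>d. 0)}"

definition boundaries :: "'a rel \<Rightarrow> int \<Rightarrow> ('a set \<Rightarrow> complex) set" where
  "boundaries r k = boundary r ` carrier (chain_space r (k + 1))"

text \<open>
  Quotient of a vector space by a subspace, built from cosets like \<^const>\<open>FactRing\<close>. The ring
  fields \<open>mult\<close> and \<open>one\<close> of the module record play no role in the module axioms.
\<close>
definition quotient_space :: "('a, 'b, 'm) module_scheme \<Rightarrow> 'b set \<Rightarrow> ('a, 'b set) module" where
  "quotient_space V W =
     \<lparr>carrier = a_rcosets\<^bsub>V\<^esub> W, mult = undefined, one = undefined,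
      zero = W, add = set_add V, smult = (\<lambda>a X. \<Union>x\<in>X. W +>\<^bsub>V\<^esub> (a \<odot>\<^bsub>V\<^esub> x))\<rparr>"

definition reduced_homology :: "'a rel \<Rightarrow> int \<Rightarrow> (complex, ('a set \<Rightarrow> complex) set) module" where
  "reduced_homology r k =
     quotient_space (chain_space r k\<lparr>carrier := cycles r k\<rparr>) (boundaries r k)"

text \<open>The signed permutations of the coordinates.\<close>
definition hyperoctahedral_group :: "(real ^ 'n \<Rightarrow> real ^ 'n) set" where
  "hyperoctahedral_group =
     {g. \<exists>p s. p permutes UNIV \<and> (\<forall>i. s i \<in> {1, -1}) \<and>
               g = (\<lambda>x. vec_lambda (\<lambda>i. s i * vec_nth x (p i)))}"

definition BC_derangements :: "(real ^ 'n \<Rightarrow> real ^ 'n) set" where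
  "BC_derangements =
     {g \<in> hyperoctahedral_group. \<forall>v. v extreme_point_of cross_polytope \<longrightarrow> g v \<noteq> v}"

end

theory Submission
  imports Defs
begin

text \<open>
  The Rees product has no chains with \<open>n + 1\<close> elements, so its homology in degree \<open>n - 1\<close> is the
  space of top cycles. A maximal chain is a word \<open>(a\<^sub>1, s\<^sub>1) \<dots> (a\<^sub>n, s\<^sub>n)\<close>: the nonzero integers
  \<open>a\<^sub>i\<close>, whose absolute values form a permutation of \<open>1, \<dots>, n\<close>, are the vertices added one by
  one, and \<open>s\<^sub>i \<in> {0, 1}\<close> (with \<open>s\<^sub>1 = 0\<close>) are the steps in the chain \<open>C\<^sub>n\<close>. A function on words is a cycle
  iff its sum vanishes over every set of words that agree outside one level. An EL-type labelling
  shows that cycles correspond bijectively to arbitrary functions on the words without ascents: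
  each such set contains exactly one word with an ascent at that level, its lexicographically least
  member, so the cycle condition determines the values at words with ascents by downward recursion.

  Let \<open>N(T)\<close> count the words without ascents on the letters \<open>T\<close>. Summing \<open>N(T)\<close> over all subsets
  \<open>T\<close> of a \<open>k\<close>-set gives the number of words without ascents below the last level, which a
  bijection shows to be \<open>2\<^sup>k k!\<close>. Signed derangements satisfy the same identity (split signed
  permutations by the set of points that they do not fix), so the two counts agree.
\<close>

section \<open>Cycles in systems with ascents\<close>

text \<open>The recursion is overdetermined: a word with several ascents carries one condition per
  ascent but has only one value. Therefore leastness is required in the joint fibre of every set of
  ascents, not just in the fibre of a single level; for two levels it makes the conditions
  equivalent once all larger words satisfy theirs. An ascent at the last level is a comparison with
  a virtual final letter \<open>(0, 0)\<close>, as if a top element closed every chain. The count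
  2^k k! arises by inserting letters: each of the 2k signed letters extends every word on the other
  k - 1 absolute values in exactly one way. Subsets enter because a word without inner ascents is a
  word without ascents followed by a run of negative letters with step 0, and this run may use any
  subset of the letters. The subset sums are inverted by induction, so no direct bijection between
  words and derangements is constructed.\<close>

locale level_system =
  fixes C :: "'c set" and n :: nat and lev :: "'c \<Rightarrow> nat \<Rightarrow> 'l"
begin

text \<open>All chains that result from \<open>c\<close> by refilling the levels in
  \<open>K\<close>. For \<open>K = {k}\<close> these are the maximal chains through one
  codimension-one face of \<open>c\<close>.\<close>

definition fibre :: "nat set \<Rightarrow> 'c \<Rightarrow> 'c set" where
  "fibre K c = {c' \<in> C. \<forall>l<n. l \<notin> K \<longrightarrow> lev c' l = lev c l}"

end

text \<open>Built on a smaller locale so that \<open>fibre\<close> can occur in the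
  assumptions.\<close>

locale ascent_system = level_system C n lev
  for C :: "'c set" and n :: nat and lev :: "'c \<Rightarrow> nat \<Rightarrow> 'l" +
  fixes lt :: "'c rel" and asc :: "nat \<Rightarrow> 'c \<Rightarrow> bool"
  assumes fin: "finite C" and tr: "trans lt" and irr: "irrefl lt"
    and asc_least: "\<And>K c c'. c \<in> C \<Longrightarrow> K \<subseteq> {..<n} \<Longrightarrow> (\<And>k. k \<in> K \<Longrightarrow> asc k c) \<Longrightarrow>
                      c' \<in> fibre K c \<Longrightarrow> c' \<noteq> c \<Longrightarrow> (c, c') \<in> lt"
    and asc_ex: "\<And>k c. c \<in> C \<Longrightarrow> k < n \<Longrightarrow> \<exists>c' \<in> fibre {k} c. asc k c'"
begin

definition desc :: "'c set" where
  "desc = {c \<in> C. \<forall>k<n. \<not> asc k c}"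

text \<open>Reversed, because the value at a word is computed from the values at larger
  words.\<close>

definition down :: "'c rel" where
  "down = {(c', c). c \<in> C \<and> c' \<in> C \<and> (c, c') \<in> lt}"

lemma wf_down: "wf down"
proof (rule finite_acyclic_wf)
  have "down \<subseteq> C \<times> C" by (auto simp: down_def)
  then show "finite down" using fin by (meson finite_SigmaI finite_subset)
  have "trans down" using tr by (auto simp: down_def trans_def)
  moreover have "irrefl down" using irr by (auto simp: down_def irrefl_def)
  ultimately show "acyclic down" by (simp add: acyclic_irrefl)
qed

lemma fibre_eq: "c' \<in> fibre K c \<Longrightarrow> fibre K c' = fibre K c"
  by (auto simp: fibre_def)

lemma fibre_self: "c \<in> C \<Longrightarrow> c \<in> fibre K c"
  by (auto simp: fibre_def)

lemma fibre_mono: "K \<subseteq> L \<Longrightarrow> fibre K c \<subseteq> fibre L c"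
  by (auto simp: fibre_def)

lemma fibre_subset: "fibre K c \<subseteq> C"
  by (auto simp: fibre_def)

lemma finite_fibre: "finite (fibre K c)"
  using fibre_subset fin finite_subset by blast

lemma asc_unique:
  assumes "c \<in> C" "k < n" "asc k c" "c' \<in> fibre {k} c" "asc k c'"
  shows "c' = c"
proof (rule ccontr)
  assume ne: "c' \<noteq> c"
  have "c' \<in> C" using assms fibre_subset by blast
  have "(c, c') \<in> lt" using asc_least[of c "{k}" c'] assms ne by auto
  moreover have "(c', c) \<in> lt"
    using asc_least[of c' "{k}" c] assms ne \<open>c' \<in> C\<close> fibre_eq[OF assms(4)] fibre_self[of c] by auto
  ultimately show False using tr irr by (meson irrefl_def transD)
qed

text \<open>
  Every \<open>{k}\<close>-fibre inside the joint fibre other than that of \<open>c\<close> has its least element above \<open>c\<close>.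
  Used with two levels \<open>i, k \<in> L\<close>, this shows that the sums over the \<open>{i}\<close>- and the \<open>{k}\<close>-fibre of \<open>c\<close>
  agree, so that only one of them has to be prescribed.
\<close>
lemma sum_joint_fibre:
  fixes f :: "'c \<Rightarrow> complex"
  assumes c: "c \<in> C" and L: "L \<subseteq> {..<n}" "\<And>l. l \<in> L \<Longrightarrow> asc l c" and k: "k \<in> L"
    and zero: "\<And>e. e \<in> C \<Longrightarrow> (c, e) \<in> lt \<Longrightarrow> asc k e \<Longrightarrow> sum f (fibre {k} e) = 0"
  shows "sum f (fibre L c) = sum f (fibre {k} c)"
proof -
  let ?J = "fibre L c"
  let ?E = "{e \<in> ?J. asc k e}"
  have kn: "k < n" using k L by auto
  have sub: "fibre {k} e \<subseteq> ?J" if "e \<in> ?J" for e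
    using fibre_mono[of "{k}" L e] fibre_eq[OF that] k by auto
  have J: "?J = (\<Union>e\<in>?E. fibre {k} e)"
  proof
    show "(\<Union>e\<in>?E. fibre {k} e) \<subseteq> ?J" using sub by auto
    show "?J \<subseteq> (\<Union>e\<in>?E. fibre {k} e)"
    proof
      fix x assume x: "x \<in> ?J"
      then have xC: "x \<in> C" using fibre_subset by blast
      obtain e where e: "e \<in> fibre {k} x" "asc k e" using asc_ex[OF xC kn] by blast
      then have "e \<in> ?E" using sub[OF x] by auto
      moreover have "x \<in> fibre {k} e" using fibre_eq[OF e(1)] fibre_self[OF xC] by auto
      ultimately show "x \<in> (\<Union>e\<in>?E. fibre {k} e)" by blast
    qed
  qed
  have disj: "fibre {k} e \<inter> fibre {k} e' = {}" if "e \<in> ?E" "e' \<in> ?E" "e \<noteq> e'" for e e'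
  proof (rule ccontr)
    assume "\<not> ?thesis"
    then obtain x where "x \<in> fibre {k} e" "x \<in> fibre {k} e'" by blast
    then have eq: "fibre {k} e = fibre {k} e'" using fibre_eq by metis
    have eC: "e \<in> C" "e' \<in> C" using that fibre_subset by auto
    then have "e' \<in> fibre {k} e" using eq fibre_self by auto
    then show False using asc_unique[of e k e'] that eC kn by auto
  qed
  have "sum f ?J = (\<Sum>e\<in>?E. sum f (fibre {k} e))"
    by (subst J, rule sum.UNION_disjoint) (use finite_fibre disj in auto)
  also have "\<dots> = (\<Sum>e\<in>{c}. sum f (fibre {k} e))"
  proof (rule sum.mono_neutral_right)
    show "finite ?E" using finite_fibre by auto
    show "{c} \<subseteq> ?E" using c L k fibre_self by auto
    show "\<forall>e\<in>?E - {c}. sum f (fibre {k} e) = 0"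
    proof
      fix e assume e: "e \<in> ?E - {c}"
      then have "(c, e) \<in> lt" using asc_least[of c L e] c L by auto
      then show "sum f (fibre {k} e) = 0" using zero[of e] e fibre_subset by auto
    qed
  qed
  finally show ?thesis by simp
qed

theorem cycle_exists:
  fixes \<phi> :: "'c \<Rightarrow> complex"
  obtains f where "\<And>c. c \<notin> C \<Longrightarrow> f c = 0" "\<And>c. c \<in> desc \<Longrightarrow> f c = \<phi> c"
    "\<And>c k. c \<in> C \<Longrightarrow> k < n \<Longrightarrow> sum f (fibre {k} c) = 0"
proof -
  \<comment> \<open>Any ascent will do: its condition defines the value at \<open>c\<close>, and the
    conditions at the other ascents have to follow.\<close>
  define \<kappa> where "\<kappa> c = (SOME k. k < n \<and> asc k c)" for c
  have \<kappa>: "\<kappa> c < n" "asc (\<kappa> c) c" if "c \<in> C" "c \<notin> desc" for c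
    using someI_ex[of "\<lambda>k. k < n \<and> asc k c"] that by (auto simp: \<kappa>_def desc_def)
  define F where "F g c = (if c \<notin> C then 0 else if c \<in> desc then \<phi> c
      else - sum g (fibre {\<kappa> c} c - {c}))" for g :: "'c \<Rightarrow> complex" and c
  define f where "f = wfrec down F"
  have f: "f c = F f c" for c
  proof -
    have "f c = F (cut f down c) c" unfolding f_def by (rule wfrec[OF wf_down])
    also have "\<dots> = F f c"
    proof -
      have "sum (cut f down c) (fibre {\<kappa> c} c - {c}) = sum f (fibre {\<kappa> c} c - {c})"
        if c: "c \<in> C" "c \<notin> desc"
      proof (rule sum.cong[OF refl])
        fix x assume x: "x \<in> fibre {\<kappa> c} c - {c}"
        then have "(c, x) \<in> lt" using asc_least[of c "{\<kappa> c}" x] c \<kappa>[OF c] by auto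
        then have "(x, c) \<in> down" using c x fibre_subset by (auto simp: down_def)
        then show "cut f down c x = f x" by (simp add: cut_apply)
      qed
      then show ?thesis by (simp add: F_def)
    qed
    finally show ?thesis .
  qed
  have main: "\<forall>k<n. asc k c \<longrightarrow> sum f (fibre {k} c) = 0" if "c \<in> C" for c
    using wf_down that
  proof (induction c rule: wf_induct_rule)
    case (less c)
    have IH: "sum f (fibre {k} e) = 0" if "e \<in> C" "(c, e) \<in> lt" "asc k e" "k < n" for e k
      using less that by (auto simp: down_def)
    show ?case
    proof (intro allI impI)
      fix k assume k: "k < n" "asc k c"
      then have nd: "c \<notin> desc" by (auto simp: desc_def)
      let ?i = "\<kappa> c"
      note i = \<kappa>[OF less.prems nd]
      have "f c = - sum f (fibre {?i} c - {c})" using f[of c] less.prems nd by (simp add: F_def)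
      then have i0: "sum f (fibre {?i} c) = 0"
        using sum.remove[OF finite_fibre fibre_self[OF less.prems], of f "{?i}"] by simp
      \<comment> \<open>All other ascending words of the joint fibre are larger, so
        \<open>IH\<close> removes their fibres from the sum, whichever of the two levels is used to
        partition it.\<close>
      have "sum f (fibre {?i, k} c) = sum f (fibre {?i} c)"
        by (rule sum_joint_fibre) (use less.prems i k IH in auto)
      moreover have "sum f (fibre {?i, k} c) = sum f (fibre {k} c)"
        by (rule sum_joint_fibre) (use less.prems i k IH in auto)
      ultimately show "sum f (fibre {k} c) = 0" using i0 by simp
    qed
  qed
  show ?thesis
  proof
    show "f c = 0" if "c \<notin> C" for c using f[of c] that by (simp add: F_def)
    show "f c = \<phi> c" if "c \<in> desc" for c using f[of c] that by (simp add: F_def desc_def)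
    show "sum f (fibre {k} c) = 0" if "c \<in> C" "k < n" for c k
    proof -
      \<comment> \<open>Each fibre has an ascending member, so the conditions proved at ascents
        cover all fibres.\<close>
      obtain e where e: "e \<in> fibre {k} c" "asc k e" using asc_ex[OF \<open>c \<in> C\<close> \<open>k < n\<close>] by blast
      moreover have "e \<in> C" using e(1) fibre_subset by blast
      ultimately show ?thesis using main[of e] \<open>k < n\<close> fibre_eq[OF e(1)] by auto
    qed
  qed
qed

text \<open>At an ascent all other members of the fibre are larger, hence vanish by induction, and
  the fibre sum reduces to the value itself.\<close>

theorem cycle_unique:
  fixes f :: "'c \<Rightarrow> complex"
  assumes "\<And>c. c \<in> desc \<Longrightarrow> f c = 0"
    and "\<And>c k. c \<in> C \<Longrightarrow> k < n \<Longrightarrow> sum f (fibre {k} c) = 0"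
    and "c \<in> C"
  shows "f c = 0"
  using wf_down assms(3)
proof (induction c rule: wf_induct_rule)
  case (less c)
  show ?case
  proof (cases "c \<in> desc")
    case False
    then obtain k where k: "k < n" "asc k c" using less.prems by (auto simp: desc_def)
    have "f e = 0" if "e \<in> fibre {k} c - {c}" for e
    proof -
      have "(c, e) \<in> lt" using asc_least[of c "{k}" e] less.prems k that by auto
      then show ?thesis using less fibre_subset that by (auto simp: down_def)
    qed
    then have "sum f (fibre {k} c) = f c"
      using sum.remove[OF finite_fibre fibre_self[OF less.prems], of f "{k}"] by simp
    then show ?thesis using assms(2)[OF less.prems k(1)] by simp
  qed (use assms in auto)
qed

end

section \<open>Words in signed letters\<close>

text \<open>The length forces each absolute value to occur exactly once. The first step is 0 because
  a vertex has rank 0 in \<open>PCP_minus\<close>, which leaves only height 0 in the chain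
  poset.\<close>

definition words :: "int set \<Rightarrow> (int \<times> nat) list set" where
  "words S = {w. length w = card S \<and> (\<lambda>x. \<bar>fst x\<bar>) ` set w = S \<and> snd ` set w \<subseteq> {0, 1} \<and>
                 (w \<noteq> [] \<longrightarrow> snd (hd w) = 0)}"

text \<open>The element of the Rees product reached after \<open>k + 1\<close> letters, with its
  face recorded by vertex labels.\<close>

definition word_level :: "(int \<times> nat) list \<Rightarrow> nat \<Rightarrow> int set \<times> nat" where
  "word_level w k = (fst ` set (take (Suc k) w), sum_list (map snd (take (Suc k) w)))"

text \<open>The last case is the first one for a letter \<open>(0, 0)\<close> placed behind the
  word.\<close>

definition word_asc :: "nat \<Rightarrow> (int \<times> nat) list \<Rightarrow> bool" where
  "word_asc k w = (if Suc k < length w then fst (w ! k) < fst (w ! Suc k) \<and> snd (w ! k) \<le> snd (w ! Suc k)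
                   else fst (w ! k) < 0 \<and> snd (w ! k) = 0)"

text \<open>Chosen as a strict order on letters that refines the componentwise one; the leastness
  proof establishes componentwise inequality at the first difference.\<close>

definition word_less :: "(int \<times> nat) list rel" where
  "word_less = lexord {(x, y). snd x < snd y \<or> snd x = snd y \<and> fst x < fst y}"

lemma finite_words:
  assumes "finite S"
  shows "finite (words S)"
proof (rule finite_subset)
  show "words S \<subseteq> {w. set w \<subseteq> (S \<union> uminus ` S) \<times> {0, 1} \<and> length w = card S}"
  proof (intro subsetI CollectI conjI)
    fix w and x :: "int \<times> nat" assume w: "w \<in> words S" and x: "x \<in> set w"
    then have "\<bar>fst x\<bar> \<in> S" "snd x \<in> {0, 1}" by (auto simp: words_def)
    then have "fst x \<in> S \<union> uminus ` S"
      by (cases "fst x \<ge> 0") (auto intro: image_eqI[of _ _ "- fst x"])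
    then show "x \<in> (S \<union> uminus ` S) \<times> {0, 1}" using \<open>snd x \<in> {0, 1}\<close> by (simp add: mem_Times_iff)
  qed (auto simp: words_def)
  show "finite {w. set w \<subseteq> (S \<union> uminus ` S) \<times> {0, 1 :: nat} \<and> length w = card S}"
    using assms by (intro finite_lists_length_eq) auto
qed

lemma words_distinct:
  assumes "w \<in> words S"
  shows "distinct (map (\<lambda>x. \<bar>fst x\<bar>) w)"
  using assms by (intro card_distinct) (auto simp: words_def)

lemma words_abs_eq_iff:
  assumes "w \<in> words S" "i < length w" "j < length w"
  shows "\<bar>fst (w ! i)\<bar> = \<bar>fst (w ! j)\<bar> \<longleftrightarrow> i = j"
  using nth_eq_iff_index_eq[OF words_distinct[OF assms(1)]] assms by simp

lemma words_nth:
  assumes "w \<in> words S" "i < length w"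
  shows "snd (w ! i) \<le> 1" "\<bar>fst (w ! i)\<bar> \<in> S"
proof -
  have "w ! i \<in> set w" using assms by simp
  then have "snd (w ! i) \<in> snd ` set w" "\<bar>fst (w ! i)\<bar> \<in> (\<lambda>x. \<bar>fst x\<bar>) ` set w" by auto
  moreover have "snd ` set w \<subseteq> {0, 1}" "(\<lambda>x. \<bar>fst x\<bar>) ` set w = S"
    using assms by (auto simp: words_def)
  ultimately show "snd (w ! i) \<le> 1" "\<bar>fst (w ! i)\<bar> \<in> S" by auto
qed

lemma word_level_fst: "fst (word_level w k) = (\<lambda>i. fst (w ! i)) ` {i. i \<le> k \<and> i < length w}"
proof -
  have "set (take (Suc k) w) = (!) w ` {i. i \<le> k \<and> i < length w}"
    
    unfolding set_conv_nth Setcompr_eq_image[symmetric]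
    by (intro Collect_cong ex_cong1) auto
  then show ?thesis by (simp add: word_level_def image_image)
qed

lemma word_level_snd: "k < length w \<Longrightarrow> snd (word_level w k) = (\<Sum>i\<le>k. snd (w ! i))"
  by (simp add: word_level_def sum_list_sum_nth atLeast0LessThan lessThan_Suc_atMost)

section \<open>Leastness and existence of ascending words\<close>

lemma word_asc_mono:
  assumes "k \<le> m" "m < length w" "\<And>l. k \<le> l \<Longrightarrow> l < m \<Longrightarrow> word_asc l w"
  shows "fst (w ! k) \<le> fst (w ! m) \<and> snd (w ! k) \<le> snd (w ! m)"
  using assms
proof (induction m rule: dec_induct)
  case (step m)
  have "word_asc m w" using step.prems(2)[of m] step.hyps by simp
  then have "fst (w ! m) < fst (w ! Suc m) \<and> snd (w ! m) \<le> snd (w ! Suc m)"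
    using step.prems(1) by (simp add: word_asc_def)
  then show ?case using step by fastforce
qed simp

text \<open>At the first difference \<open>k\<close>, the word \<open>w\<close> ascends through a
  run of levels in \<open>K\<close>. Agreement behind the run limits what \<open>w'\<close> can have
  at \<open>k\<close> to letters of that run, and the first of these is the smallest.\<close>

lemma word_asc_least:
  assumes w: "w \<in> words S" and w': "w' \<in> words S" and K: "K \<subseteq> {..<card S}"
    and asc: "\<And>k. k \<in> K \<Longrightarrow> word_asc k w"
    and lev: "\<And>l. l < card S \<Longrightarrow> l \<notin> K \<Longrightarrow> word_level w' l = word_level w l"
    and ne: "w' \<noteq> w"
  shows "(w, w') \<in> word_less"
proof -
  let ?n = "card S"
  have len: "length w = ?n" "length w' = ?n" using w w' by (auto simp: words_def)
  have ex: "\<exists>k. k < ?n \<and> w ! k \<noteq> w' ! k"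
    using ne len by (metis nth_equalityI)
  define k where "k = (LEAST k. k < ?n \<and> w ! k \<noteq> w' ! k)"
  have k: "k < ?n" "w ! k \<noteq> w' ! k" using LeastI_ex[OF ex] by (auto simp: k_def)
  have eq: "w ! i = w' ! i" if "i < k" for i
    using not_less_Least[of i "\<lambda>k. k < ?n \<and> w ! k \<noteq> w' ! k"] that k by (auto simp: k_def)
  have letter: "\<exists>l. k \<le> l \<and> l \<le> m \<and> l < ?n \<and> \<bar>fst (w' ! k)\<bar> = \<bar>fst (w ! l)\<bar>"
    if ex_l: "\<exists>l\<le>m. l < ?n \<and> \<bar>fst (w' ! k)\<bar> = \<bar>fst (w ! l)\<bar>" for m
  proof -
    obtain l where l: "l \<le> m" "l < ?n" "\<bar>fst (w' ! k)\<bar> = \<bar>fst (w ! l)\<bar>" using ex_l by blast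
    have "\<not> l < k"
    proof
      assume "l < k"
      then show False using l eq[of l] words_abs_eq_iff[OF w', of k l] k len by simp
    qed
    then show ?thesis using l by (intro exI[of _ l]) simp
  qed
  have le: "fst (w ! k) \<le> fst (w' ! k) \<and> snd (w ! k) \<le> snd (w' ! k)"
  proof (cases "\<exists>m. k \<le> m \<and> m < ?n \<and> m \<notin> K")
    case True
    \<comment> \<open>The end of the run: the first level from \<open>k\<close> on where the words
      must agree. Both coordinates of \<open>w\<close> are monotone on positions \<open>k\<close> to
      \<open>m\<close>.\<close>
    define m where "m = (LEAST m. k \<le> m \<and> m < ?n \<and> m \<notin> K)"
    have m: "k \<le> m" "m < ?n" "m \<notin> K" using LeastI_ex[OF True] by (auto simp: m_def)
    have "l \<in> K" if "k \<le> l" "l < m" for l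
      using not_less_Least[of l "\<lambda>m. k \<le> m \<and> m < ?n \<and> m \<notin> K"] that m by (auto simp: m_def)
    then have mono: "fst (w ! k) \<le> fst (w ! l) \<and> snd (w ! k) \<le> snd (w ! l)" if "k \<le> l" "l \<le> m" for l
      using that word_asc_mono[of k l w] asc len m by simp
    have lev_m: "word_level w' m = word_level w m" using lev m by blast
    have "fst (w' ! k) \<in> fst (word_level w m)"
      unfolding lev_m[symmetric] word_level_fst using m k len by auto
    then obtain l0 where l0: "l0 \<le> m" "l0 < ?n" "fst (w' ! k) = fst (w ! l0)"
      unfolding word_level_fst using len by auto
    have "k \<le> l0"
    proof (rule ccontr)
      assume "\<not> k \<le> l0"
      then show False using l0 eq[of l0] words_abs_eq_iff[OF w', of k l0] k len by simp
    qed
    then have f: "fst (w ! k) \<le> fst (w' ! k)" using mono l0 by simp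
    have s: "snd (w ! k) \<le> snd (w' ! k)"
    \<comment> \<open>A step 1 of \<open>w\<close> at \<open>k\<close> would make all its steps up
      to \<open>m\<close> equal to 1, and \<open>w'\<close> with step 0 at \<open>k\<close> could
      not reach the same height at \<open>m\<close>.\<close>
    proof (rule ccontr)
      assume c: "\<not> ?thesis"
      have "snd (w ! k) \<le> 1" using words_nth(1)[OF w] k len by simp
      then have c': "snd (w' ! k) = 0" "snd (w ! k) = 1" using c by auto
      have split: "{..m} = {..<k} \<union> {k..m}" using m by auto
      have "(\<Sum>i\<le>m. snd (w' ! i)) = (\<Sum>i\<le>m. snd (w ! i))"
        using word_level_snd[of m w] word_level_snd[of m w'] lev_m m len by simp
      then have "(\<Sum>i\<in>{k..m}. snd (w' ! i)) = (\<Sum>i\<in>{k..m}. snd (w ! i))"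
        unfolding split using eq by (subst (asm) (1 2) sum.union_disjoint) auto
      moreover have "(\<Sum>i\<in>{k..m}. snd (w' ! i)) < (\<Sum>i\<in>{k..m}. snd (w ! i))"
      proof (rule sum_strict_mono_ex1)
        show "\<forall>i\<in>{k..m}. snd (w' ! i) \<le> snd (w ! i)"
        proof
          fix i assume i: "i \<in> {k..m}"
          then have "1 \<le> snd (w ! i)" using mono[of i] c' by simp
          moreover have "snd (w' ! i) \<le> 1" using words_nth(1)[OF w'] i m len by simp
          ultimately show "snd (w' ! i) \<le> snd (w ! i)" by simp
        qed
        show "\<exists>i\<in>{k..m}. snd (w' ! i) < snd (w ! i)"
          using m c' by (intro bexI[of _ k]) auto
      qed simp
      ultimately show False by simp
    qed
    show ?thesis using f s ..
  next
    \<comment> \<open>The run extends to the end, so its last letter is negative with step 0. By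
      monotonicity this holds along the whole run; up to sign, the letter of \<open>w'\<close> at
      \<open>k\<close> is one of these, so it cannot be smaller.\<close>
    case False
    then have inK: "l \<in> K" if "k \<le> l" "l < ?n" for l using that by blast
    have mono: "fst (w ! k) \<le> fst (w ! l) \<and> snd (w ! k) \<le> snd (w ! l)" if "k \<le> l" "l < ?n" for l
      using that word_asc_mono[of k l w] asc inK len by simp
    have "word_asc (?n - 1) w" using asc inK[of "?n - 1"] k by simp
    then have last: "fst (w ! (?n - 1)) < 0" "snd (w ! (?n - 1)) = 0"
      using k len by (auto simp: word_asc_def)
    have neg: "fst (w ! l) < 0" if "k \<le> l" "l < ?n" for l
    proof -
      have "fst (w ! l) \<le> fst (w ! (?n - 1))"
        using word_asc_mono[of l "?n - 1" w] asc inK len that by simp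
      then show ?thesis using last by simp
    qed
    have "\<bar>fst (w' ! k)\<bar> \<in> (\<lambda>x. \<bar>fst x\<bar>) ` set w"
      using words_nth(2)[OF w'] w k len by (auto simp: words_def)
    then have "\<exists>l\<le>?n. l < ?n \<and> \<bar>fst (w' ! k)\<bar> = \<bar>fst (w ! l)\<bar>"
      unfolding image_iff Bex_def in_set_conv_nth len by (metis less_imp_le)
    then obtain l where l: "k \<le> l" "l < ?n" "\<bar>fst (w' ! k)\<bar> = \<bar>fst (w ! l)\<bar>"
      using letter by blast
    have "fst (w ! k) \<le> fst (w' ! k)" using mono[OF l(1,2)] neg[OF l(1,2)] l(3) by linarith
    moreover have "snd (w ! k) \<le> snd (w' ! k)" using mono[of "?n - 1"] last k by simp
    ultimately show ?thesis ..
  qed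
  then have "snd (w ! k) < snd (w' ! k) \<or> snd (w ! k) = snd (w' ! k) \<and> fst (w ! k) < fst (w' ! k)"
    using k by (metis le_neq_implies_less order_le_less prod.expand)
  moreover have "take k w = take k w'" using eq k len by (intro nth_equalityI) auto
  ultimately show ?thesis using k len by (auto simp: word_less_def lexord_take_index_conv)
qed

text \<open>The other levels fix only the set of the two letters around level \<open>k\<close> and
  the sum of their steps, so both pairs can be sorted independently. At the last level the letter
  may change its sign, and the negative one with step 0 ascends.\<close>

lemma word_asc_exists:
  assumes w: "w \<in> words S" and k: "k < card S" and S: "0 \<notin> S"
  obtains w' where "w' \<in> words S" "\<And>l. l < card S \<Longrightarrow> l \<noteq> k \<Longrightarrow> word_level w' l = word_level w l"
    "word_asc k w'"
proof -
  have len: "length w = card S" using w by (auto simp: words_def)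
  show thesis
  proof (cases "Suc k < card S")
    case True
    define x y u v where "x = w ! k" and "y = w ! Suc k" and "u = take k w" and "v = drop (Suc (Suc k)) w"
    have weq: "w = u @ x # y # v"
      unfolding x_def y_def u_def v_def using True len k
      by (metis Cons_nth_drop_Suc append_take_drop_id)
    have lu: "length u = k" using len k by (simp add: u_def)
    define x' y' where "x' = (min (fst x) (fst y), min (snd x) (snd y))"
      and "y' = (max (fst x) (fst y), max (snd x) (snd y))"
    let ?w = "u @ x' # y' # v"
    have f: "{fst x', fst y'} = {fst x, fst y}" and s: "snd x' + snd y' = snd x + snd y"
      by (auto simp: x'_def y'_def min_def max_def)
    have fs: "{\<bar>fst x'\<bar>, \<bar>fst y'\<bar>} = {\<bar>fst x\<bar>, \<bar>fst y\<bar>}" "{snd x', snd y'} = {snd x, snd y}"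
      by (auto simp: x'_def y'_def min_def max_def)
    have ne: "fst x \<noteq> fst y" using words_abs_eq_iff[OF w, of k "Suc k"] True len
      by (auto simp: x_def y_def)
    show thesis
    proof
      have "(\<lambda>x. \<bar>fst x\<bar>) ` set ?w = (\<lambda>x. \<bar>fst x\<bar>) ` set w"
        unfolding weq using fs(1) by (auto simp: insert_commute) 
      moreover have "snd ` set ?w = snd ` set w"
        unfolding weq using fs(2) by auto
      \<comment> \<open>For \<open>k = 0\<close> the new first step is a minimum with the old first
        step, which is 0.\<close>
      moreover have "snd (hd ?w) = 0"
        using w by (cases u) (auto simp: words_def weq x'_def)
      moreover have "length ?w = length w" by (simp add: weq)
      ultimately show "?w \<in> words S" using w by (auto simp: words_def)
      show "word_level ?w l = word_level w l" if "l < card S" "l \<noteq> k" for l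
      proof (cases "l < k")
        case True
        then show ?thesis by (simp add: weq word_level_def lu)
      next
        case False
        then have "k < l" using \<open>l \<noteq> k\<close> by simp
        \<comment> \<open>A prefix of length \<open>Suc l\<close> with \<open>l > k\<close> contains
          both altered letters, so only their set and the sum of their steps matter.\<close>
        then have j: "Suc l - k = Suc (Suc (l - k - 1))" by simp
        have "fst ` set (r @ x' # y' # t) = fst ` set (r @ x # y # t)" for r t
        proof -
          have "fst ` set (r @ x' # y' # t) = fst ` set r \<union> {fst x', fst y'} \<union> fst ` set t" by auto
          then show ?thesis unfolding f by auto
        qed
        then show ?thesis using s
          unfolding weq word_level_def take_append lu j by simp
      qed
      show "word_asc k ?w" using True len ne lu
        by (auto simp: word_asc_def nth_append weq x'_def y'_def)
    qed
  next
    case False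
    then have kl: "card S = Suc k" using k by simp
    define x u where "x = w ! k" and "u = take k w"
    have weq: "w = u @ [x]"
      unfolding x_def u_def using kl len by (metis lessI take_Suc_conv_app_nth take_all_iff order_refl)
    have lu: "length u = k" using len k by (simp add: u_def)
    let ?w = "u @ [(- \<bar>fst x\<bar>, 0)]"
    have "\<bar>fst x\<bar> \<in> S" unfolding x_def using words_nth(2)[OF w] len k by simp
    then have x0: "fst x \<noteq> 0" using S by auto
    show thesis
    proof
      show "?w \<in> words S" using w by (cases u) (auto simp: words_def weq)
      show "word_level ?w l = word_level w l" if "l < card S" "l \<noteq> k" for l
        using that kl lu by (simp add: weq word_level_def)
      show "word_asc k ?w" using kl lu x0 by (auto simp: word_asc_def nth_append)
    qed
  qed
qed

section \<open>Counting descending words\<close>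

definition not_asc :: "int \<times> nat \<Rightarrow> int \<times> nat \<Rightarrow> bool" where
  "not_asc x y \<longleftrightarrow> fst y \<le> fst x \<or> snd y < snd x"

text \<open>Without the condition at the last level the family has a product formula.\<close>

definition inner_desc_words :: "int set \<Rightarrow> (int \<times> nat) list set" where
  "inner_desc_words S = {w \<in> words S. successively not_asc w}"

definition desc_words :: "int set \<Rightarrow> (int \<times> nat) list set" where
  "desc_words S = {w \<in> words S. \<forall>k<card S. \<not> word_asc k w}"

text \<open>
  Deleting the last letter with \<open>s = 0\<close> and resetting \<open>s\<close> to 0 on the letters behind it loses only
  the deleted letter: its position is recovered as the start of the longest suffix of smaller
  letters with \<open>s = 0\<close>.
\<close>
definition insert_letter :: "int \<Rightarrow> (int \<times> nat) list \<Rightarrow> (int \<times> nat) list" where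
  "insert_letter a w = (let Q = (\<lambda>x. fst x < a \<and> snd x = 0) in
     rev (dropWhile Q (rev w)) @ (a, 0) # map (apsnd (\<lambda>_. 1)) (rev (takeWhile Q (rev w))))"

definition delete_letter :: "(int \<times> nat) list \<Rightarrow> int \<times> (int \<times> nat) list" where
  "delete_letter w = (let Q = (\<lambda>x. snd x = 1) in
     (fst (hd (dropWhile Q (rev w))),
      rev (tl (dropWhile Q (rev w))) @ map (apsnd (\<lambda>_. 0)) (rev (takeWhile Q (rev w)))))"

lemma insert_letter_split:
  assumes "\<And>x. x \<in> set v \<Longrightarrow> fst x < a \<and> snd x = 0"
    and "u \<noteq> [] \<Longrightarrow> \<not> (fst (last u) < a \<and> snd (last u) = 0)"
  shows "insert_letter a (u @ v) = u @ (a, 0) # map (apsnd (\<lambda>_. 1)) v"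
proof -
  let ?Q = "\<lambda>x. fst x < a \<and> snd x = (0::nat)"
  have "takeWhile ?Q (rev (u @ v)) = rev v \<and> dropWhile ?Q (rev (u @ v)) = rev u"
    using assms by (cases u rule: rev_cases) (auto simp: takeWhile_append dropWhile_append)
  then show ?thesis by (simp add: insert_letter_def Let_def)
qed

lemma insert_letter_cases:
  obtains u v where "w = u @ v" "\<And>x. x \<in> set v \<Longrightarrow> fst x < a \<and> snd x = (0::nat)"
    "u \<noteq> [] \<Longrightarrow> \<not> (fst (last u) < a \<and> snd (last u) = 0)"
proof -
  let ?Q = "\<lambda>x. fst x < a \<and> snd x = (0::nat)"
  let ?u = "rev (dropWhile ?Q (rev w))" and ?v = "rev (takeWhile ?Q (rev w))"
  show thesis
  proof (rule that[of ?u ?v])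
    show "w = ?u @ ?v" by (metis rev_append rev_rev_ident takeWhile_dropWhile_id)
    show "\<And>x. x \<in> set ?v \<Longrightarrow> ?Q x" using set_takeWhileD by fastforce
    show "?u \<noteq> [] \<Longrightarrow> \<not> ?Q (last ?u)" using hd_dropWhile[of ?Q "rev w"] by (simp add: last_rev)
  qed
qed

lemma delete_letter_split:
  assumes "\<And>x. x \<in> set v \<Longrightarrow> snd x = 1"
  shows "delete_letter (u @ (a, 0) # v) = (a, u @ map (apsnd (\<lambda>_. 0)) v)"
proof -
  let ?Q = "\<lambda>x. snd x = (1::nat)"
  have "takeWhile ?Q (rev (u @ (a, 0) # v)) = rev v"
    "dropWhile ?Q (rev (u @ (a, 0) # v)) = (a, 0) # rev u"
    using assms by (auto simp: takeWhile_append dropWhile_append)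
  then show ?thesis by (simp add: delete_letter_def)
qed

lemma words_last_zero:
  assumes "w \<in> words S" "w \<noteq> []"
  obtains u a v where "w = u @ (a, 0) # v" "\<And>x. x \<in> set v \<Longrightarrow> snd x = 1"
proof -
  have "\<exists>x\<in>set w. snd x = 0" using assms by (auto simp: words_def intro!: bexI[of _ "hd w"])
  then obtain u x v where 1: "w = u @ x # v" "snd x = 0" "\<forall>y\<in>set v. snd y \<noteq> 0"
    using split_list_last_prop[of w "\<lambda>x. snd x = 0"] by blast
  have "snd y = 1" if "y \<in> set v" for y
  proof -
    have "snd y \<in> {0, 1}" using assms(1) that by (auto simp: words_def 1(1))
    then show ?thesis using 1(3) that by auto
  qed
  then show thesis using that[of u "fst x" v] 1 by (metis prod.collapse)
qed

text \<open>Serves insertion and deletion alike. \<open>hd (u @ [x])\<close> is the head of the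
  whole word, also for empty \<open>u\<close>.\<close>

lemma words_append_Cons:
  assumes "0 \<notin> S"
  shows "u @ x # v \<in> words S \<longleftrightarrow>
    \<bar>fst x\<bar> \<in> S \<and> (\<lambda>x. \<bar>fst x\<bar>) ` (set u \<union> set v) = S - {\<bar>fst x\<bar>} \<and> length u + length v = card (S - {\<bar>fst x\<bar>}) \<and>
    snd ` (set u \<union> set v) \<subseteq> {0, 1} \<and> snd x \<in> {0, 1} \<and> snd (hd (u @ [x])) = 0"
  (is "?L \<longleftrightarrow> ?R")
proof
  assume L: ?L
  have fin: "finite S" using L by (auto simp: words_def)
  have x: "\<bar>fst x\<bar> \<in> S" using L by (auto simp: words_def)
  have "\<bar>fst x\<bar> \<notin> (\<lambda>x. \<bar>fst x\<bar>) ` (set u \<union> set v)"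
    using words_distinct[OF L] by auto
  moreover have "insert \<bar>fst x\<bar> ((\<lambda>x. \<bar>fst x\<bar>) ` (set u \<union> set v)) = S"
    using L by (auto simp: words_def)
  ultimately have 1: "(\<lambda>x. \<bar>fst x\<bar>) ` (set u \<union> set v) = S - {\<bar>fst x\<bar>}" by blast
  have "card S = Suc (length u + length v)" using L by (simp add: words_def)
  then have 2: "length u + length v = card (S - {\<bar>fst x\<bar>})" using x fin by simp
  have 3: "snd ` (set u \<union> set v) \<subseteq> {0, 1} \<and> snd x \<in> {0, 1}" using L by (auto simp: words_def)
  have 4: "snd (hd (u @ [x])) = 0" using L by (cases u) (auto simp: words_def)
  show ?R by (intro conjI x 1 2 4 conjunct1[OF 3] conjunct2[OF 3])
next
  assume R: ?R
  have "finite (S - {\<bar>fst x\<bar>})" using R by (metis List.finite_set finite_UnI finite_imageI)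
  then have "finite S" by simp
  then have "length (u @ x # v) = card S"
    using R card.remove[of S "\<bar>fst x\<bar>"] by simp
  moreover have "(\<lambda>x. \<bar>fst x\<bar>) ` set (u @ x # v) = S"
  proof -
    have "(\<lambda>x. \<bar>fst x\<bar>) ` set (u @ x # v) = insert \<bar>fst x\<bar> ((\<lambda>x. \<bar>fst x\<bar>) ` (set u \<union> set v))" by auto
    also have "\<dots> = S" using R by blast
    finally show ?thesis .
  qed
  moreover have "snd ` set (u @ x # v) \<subseteq> {0, 1}" "snd (hd (u @ x # v)) = 0"
    using R by (auto simp: hd_append)
  ultimately show ?L by (simp add: words_def)
qed

text \<open>There is no ascent into \<open>(a, 0)\<close>, since the letter before it is at least
  \<open>a\<close> or has step 1. Behind it come smaller letters, whose common step 0 made them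
  decrease; raising all these steps to 1 changes nothing. The inserted letter is then the last one
  with step 0, which is how deletion finds it.\<close>

lemma insert_letter_mem:
  assumes S: "0 \<notin> S" and a: "\<bar>a\<bar> \<in> S" and w: "w \<in> inner_desc_words (S - {\<bar>a\<bar>})"
  shows "insert_letter a w \<in> inner_desc_words S" "delete_letter (insert_letter a w) = (a, w)"
proof -
  obtain u v where uv: "w = u @ v" "\<And>x. x \<in> set v \<Longrightarrow> fst x < a \<and> snd x = (0::nat)"
    "u \<noteq> [] \<Longrightarrow> \<not> (fst (last u) < a \<and> snd (last u) = 0)"
    using insert_letter_cases[of w a] by metis
  have ins: "insert_letter a w = u @ (a, 0) # map (apsnd (\<lambda>_. 1)) v"
    unfolding uv(1) by (rule insert_letter_split) (use uv in auto)
  have v0: "map (apsnd (\<lambda>_. 0)) (map (apsnd (\<lambda>_. 1::nat)) v) = v"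
    using uv(2) by (auto simp: map_idI prod_eq_iff)
  have "delete_letter (u @ (a, 0) # map (apsnd (\<lambda>_. 1)) v) = (a, u @ map (apsnd (\<lambda>_. 0)) (map (apsnd (\<lambda>_. 1::nat)) v))"
    by (rule delete_letter_split) auto
  then show "delete_letter (insert_letter a w) = (a, w)" using ins v0 uv(1) by simp
  have ww: "w \<in> words (S - {\<bar>a\<bar>})" and sw: "successively not_asc w"
    using w by (auto simp: inner_desc_words_def)
  have "insert_letter a w \<in> words S"
    unfolding ins words_append_Cons[OF S]
    using ww a by (auto simp: words_def uv(1) image_Un image_image hd_append)
  moreover have "successively not_asc (insert_letter a w)"
  proof -
    have 1: "successively not_asc u" "successively not_asc v"
      using sw by (auto simp: uv(1) successively_append_iff)
    have "successively (\<lambda>x y. not_asc (apsnd (\<lambda>_. 1) x) (apsnd (\<lambda>_. 1) y)) v"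
      by (rule successively_mono[OF 1(2)]) (use uv(2) in \<open>auto simp: not_asc_def\<close>)
    then have 2: "successively not_asc (map (apsnd (\<lambda>_. 1)) v)" by (simp add: successively_map)
    have 3: "successively not_asc ((a, 0) # map (apsnd (\<lambda>_. 1)) v)"
      using 2 uv(2)[of "hd v"] by (cases "v = []") (auto simp: successively_Cons not_asc_def hd_map)
    show ?thesis unfolding ins successively_append_iff
      using 1 3 uv(3) by (auto simp: not_asc_def)
  qed
  ultimately show "insert_letter a w \<in> inner_desc_words S" by (simp add: inner_desc_words_def)
qed

text \<open>Behind the last letter \<open>a\<close> of step 0 the steps are 1, so non-ascents force
  the letters to decrease from \<open>a\<close>, strictly since absolute values differ. The letter
  before \<open>a\<close> is at least \<open>a\<close> or has step 1, so the suffix that insertion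
  looks for starts exactly there.\<close>

lemma delete_letter_mem:
  assumes S: "0 \<notin> S" "S \<noteq> {}" and w: "w \<in> inner_desc_words S" and d: "delete_letter w = (a, w')"
  shows "\<bar>a\<bar> \<in> S" "w' \<in> inner_desc_words (S - {\<bar>a\<bar>})" "insert_letter a w' = w"
proof -
  have ww: "w \<in> words S" and sw: "successively not_asc w"
    using w by (auto simp: inner_desc_words_def)
  have "w \<noteq> []" using ww S by (auto simp: words_def)
  then obtain u b v where uv: "w = u @ (b, 0) # v" "\<And>x. x \<in> set v \<Longrightarrow> snd x = 1"
    using words_last_zero[OF ww] by metis
  have "(a, w') = (b, u @ map (apsnd (\<lambda>_. 0)) v)"
    using delete_letter_split[of v u b] uv d by simp
  then have [simp]: "b = a" and w': "w' = u @ map (apsnd (\<lambda>_. 0)) v" by auto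
  note wS = ww[unfolded uv(1) words_append_Cons[OF S(1)]]
  show aS: "\<bar>a\<bar> \<in> S" using wS by simp
  have s1: "successively not_asc u" "successively not_asc ((a, 0) # v)"
    and s2: "u \<noteq> [] \<Longrightarrow> not_asc (last u) (a, 0)"
    using sw by (auto simp: uv(1) successively_append_iff)
  have "successively (\<lambda>x y. fst y \<le> fst x) ((a, 0) # v)"
  proof -
    have "successively not_asc v" using s1(2) by (cases v) auto
    then have "successively (\<lambda>x y. fst y \<le> fst x) v"
      by (rule successively_mono) (metis not_asc_def uv(2) less_irrefl)
    then show ?thesis using s1(2) uv(2) by (cases v) (auto simp: not_asc_def)
  qed
  then have srt: "sorted_wrt (\<lambda>x y. fst y \<le> fst x) ((a, 0::nat) # v)"
    by (subst (asm) successively_conv_sorted_wrt) (auto simp: transp_def)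
  have lt: "fst x < a" if "x \<in> set v" for x
  proof -
    have "fst x \<le> a" using srt that by simp
    moreover have "\<bar>fst x\<bar> \<noteq> \<bar>a\<bar>" using wS that by force
    ultimately show ?thesis by auto
  qed
  have v1: "map (apsnd (\<lambda>_. 1)) (map (apsnd (\<lambda>_. 0::nat)) v) = v"
    using uv(2) by (auto simp: map_idI prod_eq_iff)
  show "insert_letter a w' = w"
    unfolding w' by (subst insert_letter_split) (use lt v1 s2 in \<open>auto simp: uv(1) not_asc_def\<close>)
  have "w' \<in> words (S - {\<bar>a\<bar>})"
  proof -
    have "length w' = card (S - {\<bar>a\<bar>})" "(\<lambda>x. \<bar>fst x\<bar>) ` set w' = S - {\<bar>a\<bar>}"
      "snd ` set w' \<subseteq> {0, 1}"
      using wS unfolding w' by (auto simp: image_Un image_image)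
    moreover have "w' \<noteq> [] \<longrightarrow> snd (hd w') = 0"
      using wS unfolding w' by (cases u; cases v) auto
    ultimately show ?thesis by (simp add: words_def)
  qed
  moreover have "successively not_asc w'"
  proof -
    have "successively (\<lambda>x y. not_asc (apsnd (\<lambda>_. 0) x) (apsnd (\<lambda>_. 0) y)) v"
      using srt by (intro successively_if_sorted_wrt) (auto simp: not_asc_def elim: sorted_wrt_mono_rel[rotated])
    then have "successively not_asc (map (apsnd (\<lambda>_. 0)) v)" by (simp add: successively_map)
    then show ?thesis unfolding w' successively_append_iff
      using s1 s2 lt by (cases v) (auto simp: not_asc_def)
  qed
  ultimately show "w' \<in> inner_desc_words (S - {\<bar>a\<bar>})" by (simp add: inner_desc_words_def)
qed

text \<open>Insertion and deletion identify these words with pairs of a signed letter,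
  \<open>2 * card S\<close> in number, and a word on the remaining absolute values.\<close>

lemma card_inner_desc_words:
  assumes "finite S" "\<And>x. x \<in> S \<Longrightarrow> 0 < x"
  shows "card (inner_desc_words S) = 2 ^ card S * fact (card S)"
  using assms
proof (induction "card S" arbitrary: S)
  case 0
  then have "inner_desc_words S = {[]}" by (auto simp: inner_desc_words_def words_def)
  then show ?case using 0 by simp
next
  case (Suc n)
  have S0: "0 \<notin> S" "S \<noteq> {}" using Suc by force+
  let ?A = "S \<union> uminus ` S"
  have absA: "\<bar>a\<bar> \<in> S \<longleftrightarrow> a \<in> ?A" for a :: int
  proof
    assume "\<bar>a\<bar> \<in> S" then show "a \<in> ?A" by (cases "a \<ge> 0") (auto intro: image_eqI[of _ _ "-a"])
  next
    assume "a \<in> ?A" then show "\<bar>a\<bar> \<in> S" using Suc.prems(2) by force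
  qed
  have finX: "finite (inner_desc_words T)" if "finite T" for T
    using finite_words[OF that] by (simp add: inner_desc_words_def)
  have "bij_betw (\<lambda>(a, w). insert_letter a w) (Sigma ?A (\<lambda>a. inner_desc_words (S - {\<bar>a\<bar>}))) (inner_desc_words S)"
    (is "bij_betw ?f ?D ?X")
  proof (rule bij_betw_byWitness[where f' = delete_letter])
    show "\<forall>p\<in>?D. delete_letter (?f p) = p" "?f ` ?D \<subseteq> ?X"
      using insert_letter_mem[OF S0(1)] absA by auto
    show "\<forall>w\<in>?X. ?f (delete_letter w) = w"
    proof
      fix w assume w: "w \<in> ?X"
      obtain a w' where d: "delete_letter w = (a, w')" by fastforce
      show "?f (delete_letter w) = w" using delete_letter_mem(3)[OF S0 w d] d by simp
    qed
    show "delete_letter ` ?X \<subseteq> ?D"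
    proof
      fix p assume "p \<in> delete_letter ` ?X"
      then obtain w where w: "w \<in> ?X" "delete_letter w = (fst p, snd p)" by auto
      then show "p \<in> ?D" using delete_letter_mem(1,2)[OF S0 w] absA by (cases p) auto
    qed
  qed
  then have "card (inner_desc_words S) = card (Sigma ?A (\<lambda>a. inner_desc_words (S - {\<bar>a\<bar>})))"
    by (metis bij_betw_same_card)
  also have "\<dots> = (\<Sum>a\<in>?A. card (inner_desc_words (S - {\<bar>a\<bar>})))"
    using Suc.prems finX by (subst card_SigmaI) auto
  also have "\<dots> = (\<Sum>a\<in>?A. 2 ^ n * fact n)"
  proof (rule sum.cong[OF refl])
    fix a assume "a \<in> ?A"
    then have "\<bar>a\<bar> \<in> S" using absA by blast
    then have "card (S - {\<bar>a\<bar>}) = n" using Suc by (simp add: card_Diff_singleton)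
    then show "card (inner_desc_words (S - {\<bar>a\<bar>})) = 2 ^ n * fact n"
      using Suc.hyps(1)[of "S - {\<bar>a\<bar>}"] Suc.prems by simp
  qed
  also have "card ?A = 2 * Suc n"
  proof -
    have "S \<inter> uminus ` S = {}"
    proof (rule ccontr)
      assume "\<not> ?thesis"
      then obtain x where "x \<in> S" "- x \<in> S" by auto
      then show False using Suc.prems(2)[of x] Suc.prems(2)[of "- x"] by simp
    qed
    then show ?thesis using Suc by (subst card_Un_disjoint) (auto simp: card_image inj_on_def)
  qed
  then have "(\<Sum>a\<in>?A. 2 ^ n * fact n) = 2 ^ Suc n * (fact (Suc n) :: nat)"
    by (simp add: algebra_simps)
  finally show ?case using Suc.hyps(2) by simp
qed


section \<open>Splitting off the final negative run\<close>

definition append_negatives :: "int set \<Rightarrow> (int \<times> nat) list \<Rightarrow> (int \<times> nat) list" where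
  "append_negatives A w = w @ map (\<lambda>a. (- a, 0)) (sorted_list_of_set A)"

definition strip_negatives :: "(int \<times> nat) list \<Rightarrow> (int \<times> nat) list" where
  "strip_negatives w = rev (dropWhile (\<lambda>x. fst x < 0 \<and> snd x = 0) (rev w))"

lemma desc_words_iff:
  "w \<in> desc_words S \<longleftrightarrow> w \<in> words S \<and> successively not_asc w \<and>
     (w \<noteq> [] \<longrightarrow> \<not> (fst (last w) < 0 \<and> snd (last w) = 0))"
proof (cases "w \<in> words S")
  case True
  then have len: "length w = card S" by (auto simp: words_def)
  have "(\<forall>k<card S. \<not> word_asc k w) \<longleftrightarrow>
     (\<forall>k. Suc k < length w \<longrightarrow> not_asc (w ! k) (w ! Suc k)) \<and>
     (w \<noteq> [] \<longrightarrow> \<not> (fst (last w) < 0 \<and> snd (last w) = 0))" (is "?L \<longleftrightarrow> ?R1 \<and> ?R2")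
  proof (intro iffI conjI)
    assume "?L"
    show ?R1
    proof (intro allI impI)
      fix k assume "Suc k < length w"
      then show "not_asc (w ! k) (w ! Suc k)"
        using \<open>?L\<close>[rule_format, of k] len by (auto simp: word_asc_def not_asc_def)
    qed
    show ?R2
    proof
      assume "w \<noteq> []"
      then have "card S - 1 < card S" using len by (cases w) auto
      then show "\<not> (fst (last w) < 0 \<and> snd (last w) = 0)"
        using \<open>w \<noteq> []\<close> \<open>?L\<close>[rule_format, of "card S - 1"] len by (auto simp: word_asc_def last_conv_nth)
    qed
  next
    assume R: "?R1 \<and> ?R2"
    show ?L
    proof (intro allI impI)
      fix k assume k: "k < card S"
      show "\<not> word_asc k w"
      proof (cases "Suc k < length w")
        case True
        then show ?thesis using R by (force simp: word_asc_def not_asc_def)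
      next
        case False
        then have "w \<noteq> []" "k = length w - 1" using k len by auto
        then show ?thesis using R by (simp add: word_asc_def last_conv_nth)
      qed
    qed
  qed
  then show ?thesis using True by (simp add: desc_words_def successively_conv_nth)
qed (simp add: desc_words_def)

text \<open>The last letter of \<open>w\<close> is nonnegative or has step 1; so it does not ascend
  into a negative letter of step 0, and stripping stops exactly there.\<close>

lemma append_negatives_mem:
  assumes S: "finite S" "\<And>x. x \<in> S \<Longrightarrow> 0 < x" and T: "T \<subseteq> S" and w: "w \<in> desc_words T"
  shows "append_negatives (S - T) w \<in> inner_desc_words S"
    and "strip_negatives (append_negatives (S - T) w) = w"
proof -
  define v where "v = map (\<lambda>a. (- a, 0::nat)) (sorted_list_of_set (S - T))"
  have app: "append_negatives (S - T) w = w @ v" by (simp add: append_negatives_def v_def)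
  have fin: "finite (S - T)" using S by simp
  have v: "fst x < 0 \<and> snd x = 0" if "x \<in> set v" for x
    using that S fin by (auto simp: v_def)
  have ww: "w \<in> words T" and sw: "successively not_asc w"
    and last: "w \<noteq> [] \<Longrightarrow> \<not> (fst (last w) < 0 \<and> snd (last w) = 0)"
    using w by (auto simp: desc_words_iff)
  show "strip_negatives (append_negatives (S - T) w) = w"
    unfolding app strip_negatives_def using v last
    by (cases w rule: rev_cases) (auto simp: dropWhile_append)
  have absv: "(\<lambda>x. \<bar>fst x\<bar>) ` set v = S - T"
  proof -
    have "(\<lambda>x. \<bar>fst x\<bar>) ` set v = (\<lambda>x. x) ` (S - T)"
      unfolding v_def set_map image_image set_sorted_list_of_set[OF fin]
      by (rule image_cong[OF refl]) (use S in force)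
    then show ?thesis by simp
  qed
  have "append_negatives (S - T) w \<in> words S"
  proof -
    have "length (w @ v) = card S"
      using ww T S fin card_mono[OF S(1) T] finite_subset[OF T S(1)]
      by (simp add: words_def v_def card_Diff_subset)
    moreover have "(\<lambda>x. \<bar>fst x\<bar>) ` set (w @ v) = S"
      using ww absv T by (auto simp: words_def image_Un)
    moreover have "snd ` set v \<subseteq> {0}" using v by auto
    then have "snd ` set (w @ v) \<subseteq> {0, 1}" using ww by (auto simp: words_def)
    moreover have "snd (hd (w @ v)) = 0" if "w @ v \<noteq> []"
      using ww v that by (cases w; cases v) (auto simp: words_def)
    ultimately show ?thesis unfolding app by (simp add: words_def)
  qed
  moreover have "successively not_asc (w @ v)"
  proof -
    have "successively (\<lambda>a b. not_asc (- a, 0) (- b, 0)) (sorted_list_of_set (S - T))"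
      by (rule successively_if_sorted_wrt, rule sorted_wrt_mono_rel[OF _ sorted_sorted_list_of_set])
        (auto simp: not_asc_def)
    then have "successively not_asc v" by (simp add: v_def successively_map)
    moreover have "not_asc (last w) (hd v)" if "w \<noteq> []" "v \<noteq> []"
      using last[OF that(1)] v[of "hd v"] that by (auto simp: not_asc_def)
    ultimately show ?thesis using sw by (auto simp: successively_append_iff)
  qed
  ultimately show "append_negatives (S - T) w \<in> inner_desc_words S"
    unfolding app by (simp add: inner_desc_words_def)
qed

lemma strip_negatives_mem:
  assumes S: "finite S" "\<And>x. x \<in> S \<Longrightarrow> 0 < x" and w: "w \<in> inner_desc_words S"
  defines "T \<equiv> (\<lambda>x. \<bar>fst x\<bar>) ` set (strip_negatives w)"
  shows "T \<subseteq> S" "strip_negatives w \<in> desc_words T" "append_negatives (S - T) (strip_negatives w) = w"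
proof -
  let ?Q = "\<lambda>x. fst x < 0 \<and> snd x = (0::nat)"
  define u v where "u = strip_negatives w" and "v = rev (takeWhile ?Q (rev w))"
  have weq: "w = u @ v" unfolding u_def v_def strip_negatives_def
    by (metis rev_append rev_rev_ident takeWhile_dropWhile_id)
  have v: "?Q x" if "x \<in> set v" for x using that set_takeWhileD by (fastforce simp: v_def)
  have last: "u \<noteq> [] \<Longrightarrow> \<not> ?Q (last u)"
    using hd_dropWhile[of ?Q "rev w"] by (simp add: u_def strip_negatives_def last_rev)
  have ww: "w \<in> words S" and sw: "successively not_asc w"
    using w by (auto simp: inner_desc_words_def)
  have Tu: "T = (\<lambda>x. \<bar>fst x\<bar>) ` set u" by (simp add: T_def u_def)
  have dist: "distinct (map (\<lambda>x. \<bar>fst x\<bar>) (u @ v))" using words_distinct[OF ww] weq by simp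
  have un: "T \<union> (\<lambda>x. \<bar>fst x\<bar>) ` set v = S" using ww by (auto simp: words_def weq Tu image_Un)
  then show "T \<subseteq> S" by blast
  have ST: "S - T = (\<lambda>x. \<bar>fst x\<bar>) ` set v" using dist un by (auto simp: Tu)
  have "length u = card T"
    using distinct_card[of "map (\<lambda>x. \<bar>fst x\<bar>) u"] dist by (simp add: Tu)
  then have "u \<in> words T" using ww by (auto simp: words_def weq Tu hd_append split: if_splits)
  then show "strip_negatives w \<in> desc_words T"
    unfolding u_def[symmetric] desc_words_iff using last sw by (auto simp: weq successively_append_iff)
  \<comment> \<open>With all steps 0, non-ascents mean decreasing negative letters, so the suffix
    lists its absolute values in increasing order and is determined by their set.\<close>
  have "sorted_list_of_set (S - T) = map (\<lambda>x. - fst x) v"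
  proof (rule sorted_distinct_set_unique)
    show "set (sorted_list_of_set (S - T)) = set (map (\<lambda>x. - fst x) v)"
      using S v unfolding ST by (auto simp: abs_if image_iff)
    have "successively not_asc v" using sw by (auto simp: weq successively_append_iff)
    then have "successively (\<lambda>x y. - fst x \<le> - fst y) v"
      by (rule successively_mono) (metis not_asc_def v less_irrefl neg_le_iff_le)
    then show "sorted (map (\<lambda>x. - fst x) v)"
      by (subst (asm) successively_conv_sorted_wrt) (auto simp: transp_def sorted_wrt_map)
    have "distinct (map (\<lambda>x. \<bar>fst x\<bar>) v)" using dist by simp
    moreover have "map (\<lambda>x. \<bar>fst x\<bar>) v = map (\<lambda>x. - fst x) v" 
      by (rule map_cong[OF refl], drule v) simp
    ultimately show "distinct (map (\<lambda>x. - fst x) v)" by metis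
  qed auto
  then have "map (\<lambda>a. (- a, 0)) (sorted_list_of_set (S - T)) = v"
    using v by (auto simp: map_idI prod_eq_iff)
  then show "append_negatives (S - T) (strip_negatives w) = w"
    unfolding append_negatives_def u_def[symmetric] using weq by simp
qed

lemma sum_card_desc_words:
  assumes S: "finite S" "\<And>x. x \<in> S \<Longrightarrow> 0 < x"
  shows "(\<Sum>T\<in>Pow S. card (desc_words T)) = 2 ^ card S * fact (card S)"
proof -
  have fin: "finite (desc_words T)" if "T \<subseteq> S" for T
    using finite_words[of T] finite_subset[OF that S(1)] by (simp add: desc_words_def)
  have abs: "(\<lambda>x. \<bar>fst x\<bar>) ` set w = T" if "w \<in> desc_words T" for w T
    using that by (auto simp: desc_words_def words_def)
  have "bij_betw (\<lambda>(T, w). append_negatives (S - T) w) (Sigma (Pow S) desc_words) (inner_desc_words S)"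
    (is "bij_betw ?f ?D ?X")
  proof (rule bij_betw_byWitness[where f' = "\<lambda>w. ((\<lambda>x. \<bar>fst x\<bar>) ` set (strip_negatives w), strip_negatives w)"])
    show "?f ` ?D \<subseteq> ?X" using append_negatives_mem(1)[OF S] by auto
    show "\<forall>p\<in>?D. ((\<lambda>x. \<bar>fst x\<bar>) ` set (strip_negatives (?f p)), strip_negatives (?f p)) = p"
      using append_negatives_mem(2)[OF S] abs by auto
  qed (use strip_negatives_mem[OF S] in auto)
  then have "card ?D = card ?X" by (rule bij_betw_same_card)
  then show ?thesis using card_inner_desc_words[OF S] fin S(1) by (subst (asm) card_SigmaI) auto
qed

section \<open>Signed derangements and comparison of the two counts\<close>

definition signed_derangements :: "'a set \<Rightarrow> (('a \<Rightarrow> 'a) \<times> ('a \<Rightarrow> real)) set" where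
  "signed_derangements S = {(p, s). p permutes S \<and> (\<forall>i\<in>S. s i \<in> {1, -1}) \<and> (\<forall>i. i \<notin> S \<longrightarrow> s i = 1) \<and>
     (\<forall>i\<in>S. \<not> (p i = i \<and> s i = 1))}"

text \<open>Signs are 1 outside the support, so each signed permutation of \<open>S\<close> is
  literally a signed derangement of one set, the points it does not fix. A point with
  \<open>p i = i\<close> and sign -1 counts as moved.\<close>

lemma sum_card_signed_derangements:
  fixes S :: "'a set"
  assumes S: "finite S"
  shows "(\<Sum>T\<in>Pow S. card (signed_derangements T)) = 2 ^ card S * fact (card S)"
proof -
  define G where "G = {p. p permutes S} \<times> {s :: 'a \<Rightarrow> real. (\<forall>i\<in>S. s i \<in> {1, -1}) \<and> (\<forall>i. i \<notin> S \<longrightarrow> s i = 1)}"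
  have signs: "bij_betw (\<lambda>A i. if i \<in> A then -1 else 1) (Pow S)
     {s :: 'a \<Rightarrow> real. (\<forall>i\<in>S. s i \<in> {1, -1}) \<and> (\<forall>i. i \<notin> S \<longrightarrow> s i = 1)}"
    (is "bij_betw ?f _ ?X")
  proof (rule bij_betw_byWitness[where f' = "\<lambda>s. {i. s i = -1}"])
    show "\<forall>s\<in>?X. ?f {i. s i = -1} = s"
      by (auto simp: fun_eq_iff)
    show "(\<lambda>s. {i. s i = -1}) ` ?X \<subseteq> Pow S"
    proof (clarsimp)
      fix s :: "'a \<Rightarrow> real" and x assume "\<forall>i. i \<notin> S \<longrightarrow> s i = 1" "s x = - 1"
      then show "x \<in> S" by (metis one_neq_neg_one)
    qed
  qed auto
  have cardG: "card G = 2 ^ card S * fact (card S)"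
    unfolding G_def card_cartesian_product card_permutations[OF refl S]
    using bij_betw_same_card[OF signs] S by (simp add: card_Pow)
  \<comment> \<open>An infinite set has \<open>card\<close> 0, while the product just computed is
    positive.\<close>
  then have finG: "finite G" by (metis card.infinite fact_nonzero mult_eq_0_iff power_not_zero zero_neq_numeral)
  have G: "G = (\<Union>T\<in>Pow S. signed_derangements T)"
  proof
    show "(\<Union>T\<in>Pow S. signed_derangements T) \<subseteq> G"
      by (auto simp: G_def signed_derangements_def intro: permutes_subset)
    show "G \<subseteq> (\<Union>T\<in>Pow S. signed_derangements T)"
    proof
      fix x assume "x \<in> G"
      then obtain p s where x: "x = (p, s)" "p permutes S" "\<forall>i\<in>S. s i \<in> {1, -1}" "\<forall>i. i \<notin> S \<longrightarrow> s i = 1"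
        by (auto simp: G_def)
      let ?T = "{i \<in> S. \<not> (p i = i \<and> s i = 1)}"
      have "p permutes ?T"
        by (rule permutes_superset[OF x(2)]) auto
      then have "x \<in> signed_derangements ?T" using x by (auto simp: signed_derangements_def)
      then show "x \<in> (\<Union>T\<in>Pow S. signed_derangements T)" by (intro UN_I[of ?T]) auto
    qed
  qed
  have moved: "T = {i. \<not> (p i = i \<and> s i = 1)}" if "(p, s) \<in> signed_derangements T" for p s and T :: "'a set"
    using that permutes_not_in[of p T] by (auto simp: signed_derangements_def)
  have disj: "signed_derangements T \<inter> signed_derangements T' = {}" if "T \<noteq> T'" for T T' :: "'a set"
  proof (rule ccontr)
    assume "\<not> ?thesis"
    then obtain p s where "(p, s) \<in> signed_derangements T" "(p, s) \<in> signed_derangements T'" by auto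
    then have "T = T'" using moved[of p s T] moved[of p s T'] by simp
    then show False using \<open>T \<noteq> T'\<close> by simp
  qed
  have "finite (signed_derangements T)" if "T \<in> Pow S" for T
    using finite_subset[OF _ finG, of "signed_derangements T"] G \<open>T \<in> Pow S\<close> by auto
  then have "card G = (\<Sum>T\<in>Pow S. card (signed_derangements T))"
    unfolding G using S disj by (intro card_UN_disjoint) auto
  then show ?thesis using cardG by simp
qed

text \<open>The sum over \<open>Pow S\<close> determines the summand of \<open>S\<close> once all
  proper subsets are known. As \<open>N\<close> sees only sizes, a bijection of the ground sets
  matches these proper subsets and the induction runs on both sides at once.\<close>

lemma eq_if_subset_sums_eq:
  fixes g :: "'a set \<Rightarrow> nat" and h :: "'b set \<Rightarrow> nat" and N :: "nat \<Rightarrow> nat"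
  assumes "finite S" "finite S'" "card S = card S'"
    and "\<And>T. T \<subseteq> S \<Longrightarrow> sum g (Pow T) = N (card T)" "\<And>T. T \<subseteq> S' \<Longrightarrow> sum h (Pow T) = N (card T)"
  shows "g S = h S'"
  using assms
proof (induction "card S" arbitrary: S S' rule: less_induct)
  case less
  obtain b where b: "bij_betw b S S'" using less.prems by (meson finite_same_card_bij)
  let ?P = "\<lambda>S. Pow S - {S}"
  have bP: "bij_betw ((`) b) (?P S) (?P S')"
    using b bij_betw_DiffI[OF bij_betw_Pow[OF b], of "{S}" "{S'}"] by (auto simp: bij_betw_def)
  have "sum g (?P S) = (\<Sum>T\<in>?P S. h (b ` T))"
  proof (rule sum.cong[OF refl])
    fix T assume T: "T \<in> ?P S"
    then have sub: "T \<subset> S" "b ` T \<subseteq> S'" using b by (auto simp: bij_betw_def)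
    show "g T = h (b ` T)"
    proof (rule less.hyps)
      show "card T < card S" using psubset_card_mono[OF less.prems(1) sub(1)] .
      show "finite T" "finite (b ` T)" using sub less.prems finite_subset by blast+
      show "card T = card (b ` T)"
        using b sub by (metis bij_betw_def card_image inj_on_subset psubset_imp_subset)
    qed (use sub less.prems in \<open>auto intro: order_trans\<close>)
  qed
  also have "\<dots> = sum h (?P S')" using sum.reindex_bij_betw[OF bP, of h] by simp
  finally have "sum g (?P S) = sum h (?P S')" .
  moreover have "sum g (Pow S) = g S + sum g (?P S)" "sum h (Pow S') = h S' + sum h (?P S')"
    using less.prems sum.remove[of "Pow S" S g] sum.remove[of "Pow S'" S' h] by auto
  ultimately show ?case using less.prems(3) less.prems(4)[of S] less.prems(5)[of S'] by simp
qed

theorem card_desc_words: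
  assumes "finite S" "\<And>x. x \<in> S \<Longrightarrow> 0 < x" and "finite (S' :: 'a set)" "card S = card S'"
  shows "card (desc_words S) = card (signed_derangements S')"
proof (rule eq_if_subset_sums_eq[where g = "\<lambda>T. card (desc_words T)" and h = "\<lambda>T. card (signed_derangements T)" and N = "\<lambda>k. 2 ^ k * fact k"])
  show "(\<Sum>T\<in>Pow T. card (desc_words T)) = 2 ^ card T * fact (card T)" if "T \<subseteq> S" for T
    using that assms by (intro sum_card_desc_words) (auto intro: finite_subset)
  show "(\<Sum>T\<in>Pow T. card (signed_derangements T)) = 2 ^ card T * fact (card T)" if "T \<subseteq> S'" for T
    using that assms by (intro sum_card_signed_derangements) (auto intro: finite_subset)
qed (use assms in auto)

section \<open>Faces of the cross-polytope\<close>

definition cross_vertices :: "(real ^ 'n) set" where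
  "cross_vertices = range (\<lambda>i. axis i 1) \<union> range (\<lambda>i. - axis i 1)"

text \<open>Polymorphic because it is applied both to vertices as vectors and to their integer
  labels.\<close>

definition antipode_free :: "'a::uminus set \<Rightarrow> bool" where
  "antipode_free B \<longleftrightarrow> (\<forall>v\<in>B. - v \<notin> B)"

lemma cross_polytope_eq: "cross_polytope = convex hull cross_vertices"
  by (simp add: cross_polytope_def cross_vertices_def)

lemma finite_cross_vertices: "finite (cross_vertices :: (real ^ 'n) set)"
  by (simp add: cross_vertices_def)

lemma uminus_cross_vertices: "- v \<in> cross_vertices \<longleftrightarrow> v \<in> (cross_vertices :: (real ^ 'n) set)"
proof -
  have "- v \<in> cross_vertices" if "v \<in> cross_vertices" for v :: "real ^ 'n"
    using that by (auto simp: cross_vertices_def)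
  from this[of v] this[of "- v"] show ?thesis by auto
qed

lemma axis_neq_uminus_axis: "axis i (1 :: real) \<noteq> - axis j 1"
proof
  assume "axis i (1 :: real) = - axis j 1"
  then have "axis i (1 :: real) $ i = (- axis j 1) $ i" by simp
  then show False by (simp add: axis_def split: if_splits)
qed

lemma cross_vertex_neq_uminus: "v \<in> cross_vertices \<Longrightarrow> v \<noteq> - v"
proof -
  assume "v \<in> cross_vertices"
  then have "v \<noteq> 0" by (auto simp: cross_vertices_def axis_eq_0_iff)
  then show ?thesis by (simp add: eq_neg_iff_add_eq_0 flip: scaleR_2)
qed

lemma inner_cross_vertices:
  fixes v w :: "real ^ 'n"
  assumes "v \<in> cross_vertices" "w \<in> cross_vertices"
  shows "v \<bullet> w = (if v = w then 1 else if v = - w then -1 else 0)"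
proof -
  obtain i j where "v = axis i 1 \<or> v = - axis i 1" "w = axis j 1 \<or> w = - axis j 1"
    using assms by (auto simp: cross_vertices_def)
  then show ?thesis
    by (elim disjE) (simp_all add: inner_axis_axis axis_eq_axis axis_neq_uminus_axis axis_neq_uminus_axis[symmetric])
qed

text \<open>The sum of \<open>B\<close> is a normal vector for the face spanned by \<open>B\<close>:
  on vertices the functional is at most 1, with equality exactly on \<open>B\<close>.\<close>

lemma inner_sum_cross_vertices:
  fixes B :: "(real ^ 'n) set"
  assumes B: "B \<subseteq> cross_vertices" "antipode_free B" and v: "v \<in> cross_vertices"
  shows "\<Sum>B \<bullet> v = (if v \<in> B then 1 else if - v \<in> B then -1 else 0)"
proof -
  have fin: "finite B" using B finite_cross_vertices finite_subset by blast
  have ne: "v \<noteq> - v" using v by (rule cross_vertex_neq_uminus)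
  have "\<Sum>B \<bullet> v = (\<Sum>b\<in>B. (if b = v then 1 else 0) + (if b = - v then -1 else 0))"
    unfolding inner_sum_left
    by (rule sum.cong[OF refl]) (use B v ne in \<open>auto simp: inner_cross_vertices subset_iff\<close>)
  also have "\<dots> = (if v \<in> B then 1 else 0) + (if - v \<in> B then -1 else 0)"
    using fin by (simp add: sum.distrib)
  finally show ?thesis using B by (auto simp: antipode_free_def)
qed

text \<open>The hyperplane where this functional is 1 contains the hull and no further vertex. Hence
  faces can be replaced by their vertex sets.\<close>

lemma hull_Int_cross_vertices:
  fixes B :: "(real ^ 'n) set"
  assumes B: "B \<subseteq> cross_vertices" "antipode_free B"
  shows "convex hull B \<inter> cross_vertices = B"
proof
  have "B \<subseteq> {x. \<Sum>B \<bullet> x = 1}" using B by (auto simp: inner_sum_cross_vertices subset_iff)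
  then have "convex hull B \<subseteq> {x. \<Sum>B \<bullet> x = 1}" by (simp add: convex_hyperplane hull_minimal)
  then show "convex hull B \<inter> cross_vertices \<subseteq> B"
    using B by (auto simp: inner_sum_cross_vertices split: if_splits)
  show "B \<subseteq> convex hull B \<inter> cross_vertices" using B by (simp add: hull_subset)
qed

lemma hull_subset_iff:
  fixes A B :: "(real ^ 'n) set"
  assumes "A \<subseteq> cross_vertices" "antipode_free A" "B \<subseteq> cross_vertices" "antipode_free B"
  shows "convex hull A \<subseteq> convex hull B \<longleftrightarrow> A \<subseteq> B"
proof
  assume "convex hull A \<subseteq> convex hull B"
  then show "A \<subseteq> B"
    using hull_Int_cross_vertices[OF assms(1,2)] hull_Int_cross_vertices[OF assms(3,4)] by blast
qed (rule hull_mono)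

lemma face_of_cross_polytope_hull:
  fixes F :: "(real ^ 'n) set"
  assumes "F face_of cross_polytope"
  shows "F = convex hull (F \<inter> cross_vertices)"
proof
  obtain S where S: "S \<subseteq> cross_vertices" "F = convex hull S"
    using face_of_convex_hull_subset[of cross_vertices F] assms finite_cross_vertices
    by (metis cross_polytope_eq finite_imp_compact)
  then have "S \<subseteq> F \<inter> cross_vertices" by (simp add: hull_subset)
  then show "F \<subseteq> convex hull (F \<inter> cross_vertices)" using S hull_mono by blast
  show "convex hull (F \<inter> cross_vertices) \<subseteq> F"
    using assms by (intro hull_minimal) (auto dest: face_of_imp_convex)
qed

lemma uminus_cross_polytope:
  fixes x :: "real ^ 'n"
  assumes "x \<in> cross_polytope"
  shows "- x \<in> cross_polytope"
proof -
  have "uminus ` (cross_polytope :: (real ^ 'n) set) = convex hull (uminus ` cross_vertices)"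
    unfolding cross_polytope_eq
    by (rule convex_hull_linear_image) (simp add: linear_uminus)
  also have "uminus ` cross_vertices = (cross_vertices :: (real ^ 'n) set)"
    by (simp add: cross_vertices_def image_Un image_image Un_commute)
  finally show ?thesis using assms by (metis cross_polytope_eq imageI)
qed

text \<open>A face with two antipodal vertices contains the centre 0, which lies between any
  \<open>x\<close> and \<open>- x\<close>, so it is the whole polytope. Conversely, an antipode-free
  set is cut out by the supporting hyperplane with normal vector its sum.\<close>

lemma face_of_cross_polytope_iff:
  fixes F :: "(real ^ 'n) set"
  shows "F face_of cross_polytope \<and> F \<noteq> cross_polytope \<longleftrightarrow>
     (\<exists>B \<subseteq> cross_vertices. antipode_free B \<and> F = convex hull B)"
proof
  assume F: "F face_of cross_polytope \<and> F \<noteq> cross_polytope"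
  have conv: "convex F" and sub: "F \<subseteq> cross_polytope"
    using F face_of_imp_convex face_of_imp_subset by blast+
  have "antipode_free (F \<inter> cross_vertices)"
    unfolding antipode_free_def
  proof (intro ballI notI)
    fix v assume v: "v \<in> F \<inter> cross_vertices" "- v \<in> F \<inter> cross_vertices"
    have "(1/2) *\<^sub>R v + (1/2) *\<^sub>R (- v) \<in> F"
      using conv v by (intro convexD) auto
    then have zero: "0 \<in> F" by simp
    have "cross_polytope \<subseteq> F"
    proof
      fix x :: "real ^ 'n" assume x: "x \<in> cross_polytope"
      show "x \<in> F"
      proof (cases "x = 0")
        case False
        have ne: "x \<noteq> - x" using False by (simp add: eq_neg_iff_add_eq_0 flip: scaleR_2)
        have "(0 :: real ^ 'n) = (1 - 1/2) *\<^sub>R x + (1/2) *\<^sub>R (- x)" by simp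
        then have "0 \<in> open_segment x (- x)"
          unfolding in_segment using ne by (intro conjI exI[of _ "1/2"]) auto
        then show ?thesis
          using F x uminus_cross_polytope[OF x] zero unfolding face_of_def by blast
      qed (use zero in simp)
    qed
    then show False using F sub by blast
  qed
  then show "\<exists>B \<subseteq> cross_vertices. antipode_free B \<and> F = convex hull B"
    using face_of_cross_polytope_hull F by (intro exI[of _ "F \<inter> cross_vertices"]) auto
next
  assume "\<exists>B \<subseteq> cross_vertices. antipode_free B \<and> F = convex hull B"
  then obtain B where B: "B \<subseteq> cross_vertices" "antipode_free B" and F: "F = convex hull B" by blast
  show "F face_of cross_polytope \<and> F \<noteq> cross_polytope"
  proof (cases "B = {}")
    case True
    \<comment> \<open>Some vertex is needed to see that the empty face is proper.\<close>
    have "axis undefined 1 \<in> (cross_polytope :: (real ^ 'n) set)"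
      unfolding cross_polytope_eq by (rule hull_inc) (simp add: cross_vertices_def)
    then show ?thesis using True F by auto
  next
    case False
    let ?c = "\<Sum>B"
    have "cross_vertices \<subseteq> {x. ?c \<bullet> x \<le> 1}" using B by (auto simp: inner_sum_cross_vertices)
    then have le: "cross_polytope \<subseteq> {x. ?c \<bullet> x \<le> 1}"
      unfolding cross_polytope_eq by (simp add: convex_halfspace_le hull_minimal)
    let ?F = "cross_polytope \<inter> {x. ?c \<bullet> x = 1}"
    have face: "?F face_of cross_polytope"
      by (rule face_of_Int_supporting_hyperplane_le) (use le in \<open>auto simp: cross_polytope_eq\<close>)
    have "cross_vertices \<subseteq> (cross_polytope :: (real ^ 'n) set)"
      unfolding cross_polytope_eq by (rule hull_subset)
    then have "x \<in> ?F \<inter> cross_vertices \<longleftrightarrow> x \<in> B" for x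
      using B(1) inner_sum_cross_vertices[OF B, of x] by (auto split: if_splits)
    then have "?F \<inter> cross_vertices = B" by blast
    then have F_eq: "?F = F" using face_of_cross_polytope_hull[OF face] F by simp
    obtain b where b: "b \<in> B" using False by blast
    then have "- b \<in> cross_vertices" using B uminus_cross_vertices by blast
    then have "- b \<in> cross_polytope" unfolding cross_polytope_eq by (rule hull_inc)
    moreover have "?c \<bullet> b = 1" using inner_sum_cross_vertices[OF B, of b] b B by auto
    then have "- b \<notin> ?F" by simp
    ultimately have "?F \<noteq> cross_polytope" by blast
    then show ?thesis using face unfolding F_eq by blast
  qed
qed

lemma extreme_point_of_cross_polytope_iff:
  fixes v :: "real ^ 'n"
  shows "v extreme_point_of cross_polytope \<longleftrightarrow> v \<in> cross_vertices"
proof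
  assume "v extreme_point_of cross_polytope"
  then show "v \<in> cross_vertices" unfolding cross_polytope_eq by (rule extreme_point_of_convex_hull)
next
  assume v: "v \<in> cross_vertices"
  then have "v \<noteq> - v" by (rule cross_vertex_neq_uminus)
  then have "{v} face_of cross_polytope \<and> {v} \<noteq> cross_polytope"
    unfolding face_of_cross_polytope_iff
    using v by (intro exI[of _ "{v}"]) (auto simp: antipode_free_def)
  then show "v extreme_point_of cross_polytope" by (simp add: face_of_singleton)
qed

definition cross_faces :: "(real ^ 'n) set set" where
  "cross_faces = {B. B \<subseteq> cross_vertices \<and> antipode_free B \<and> B \<noteq> {}}"

lemma PCP_minus_iff:
  "(F, G) \<in> (PCP_minus :: (real ^ 'n) set rel) \<longleftrightarrow>
     (\<exists>A B. A \<in> cross_faces \<and> B \<in> cross_faces \<and> A \<subseteq> B \<and> F = convex hull A \<and> G = convex hull B)"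
proof -
  have face: "F face_of cross_polytope \<and> F \<noteq> cross_polytope \<and> F \<noteq> {} \<longleftrightarrow> (\<exists>A\<in>cross_faces. F = convex hull A)"
    for F :: "(real ^ 'n) set"
  proof -
    have "F face_of cross_polytope \<and> F \<noteq> cross_polytope \<and> F \<noteq> {} \<longleftrightarrow>
      (F face_of cross_polytope \<and> F \<noteq> cross_polytope) \<and> F \<noteq> {}" by (rule conj_assoc[symmetric])
    also have "\<dots> \<longleftrightarrow> (\<exists>A\<in>cross_faces. F = convex hull A)"
    proof
      assume "(F face_of cross_polytope \<and> F \<noteq> cross_polytope) \<and> F \<noteq> {}"
      then obtain B where B: "B \<subseteq> cross_vertices" "antipode_free B" "F = convex hull B" "F \<noteq> {}"
        unfolding face_of_cross_polytope_iff by metis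
      then have "B \<in> cross_faces" by (auto simp: cross_faces_def)
      then show "\<exists>A\<in>cross_faces. F = convex hull A" using B(3) by metis
    next
      assume "\<exists>A\<in>cross_faces. F = convex hull A"
      then obtain A where A: "A \<subseteq> cross_vertices" "antipode_free A" "A \<noteq> {}" "F = convex hull A"
        by (auto simp: cross_faces_def)
      then show "(F face_of cross_polytope \<and> F \<noteq> cross_polytope) \<and> F \<noteq> {}"
        unfolding face_of_cross_polytope_iff by (metis convex_hull_eq_empty)
    qed
    finally show ?thesis .
  qed
  have sub: "A \<subseteq> B \<longleftrightarrow> convex hull A \<subseteq> convex hull B" if "A \<in> cross_faces" "B \<in> cross_faces"
    for A B :: "(real ^ 'n) set"
    using \<open>A \<in> cross_faces\<close> \<open>B \<in> cross_faces\<close> hull_subset_iff[of A B] by (simp add: cross_faces_def)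
  have "(F, G) \<in> PCP_minus \<longleftrightarrow>
    (F face_of cross_polytope \<and> F \<noteq> cross_polytope \<and> F \<noteq> {}) \<and>
    (G face_of cross_polytope \<and> G \<noteq> cross_polytope \<and> G \<noteq> {}) \<and> F \<subseteq> G"
    by (auto simp: PCP_minus_def PCP_def)
  also have "\<dots> \<longleftrightarrow> (\<exists>A\<in>cross_faces. F = convex hull A) \<and> (\<exists>B\<in>cross_faces. G = convex hull B) \<and> F \<subseteq> G"
    unfolding face ..
  also have "\<dots> \<longleftrightarrow> (\<exists>A B. A \<in> cross_faces \<and> B \<in> cross_faces \<and> A \<subseteq> B \<and> F = convex hull A \<and> G = convex hull B)"
    using sub by metis
  finally show ?thesis .
qed

section \<open>The Rees product\<close>

lemma cross_facesD:
  assumes "A \<in> cross_faces"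
  shows "finite A" "card A > 0" "convex hull A \<inter> cross_vertices = A"
proof -
  show "finite A" using assms finite_cross_vertices finite_subset by (auto simp: cross_faces_def)
  then show "card A > 0" using assms by (auto simp: cross_faces_def card_gt_0_iff)
  show "convex hull A \<inter> cross_vertices = A"
    using assms hull_Int_cross_vertices by (auto simp: cross_faces_def)
qed

lemma cross_faces_subset: "A \<in> cross_faces \<Longrightarrow> B \<subseteq> A \<Longrightarrow> B \<noteq> {} \<Longrightarrow> B \<in> cross_faces"
  by (auto simp: cross_faces_def antipode_free_def)

lemma cross_hull_eq_iff: "A \<in> cross_faces \<Longrightarrow> B \<in> cross_faces \<Longrightarrow> convex hull A = convex hull B \<longleftrightarrow> A = B"
  by (metis cross_facesD(3))

lemma PCP_minus_hull_iff:
  "A \<in> cross_faces \<Longrightarrow> B \<in> cross_faces \<Longrightarrow> (convex hull A, convex hull B) \<in> PCP_minus \<longleftrightarrow> A \<subseteq> B"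
  unfolding PCP_minus_iff by (metis cross_hull_eq_iff)

text \<open>The upper bound also makes the set of cardinalities finite, so that \<open>Max\<close>
  is meaningful.\<close>

lemma poset_rank_eqI:
  assumes "\<And>C. C \<in> Chains r \<Longrightarrow> finite C \<Longrightarrow> \<forall>c\<in>C. (c, x) \<in> r \<and> c \<noteq> x \<Longrightarrow> card C \<le> m"
    and "C \<in> Chains r" "finite C" "\<forall>c\<in>C. (c, x) \<in> r \<and> c \<noteq> x" "card C = m"
  shows "poset_rank r x = m"
  unfolding poset_rank_def
proof (rule Max_eqI)
  have "{card C |C. C \<in> Chains r \<and> finite C \<and> (\<forall>c\<in>C. (c, x) \<in> r \<and> c \<noteq> x)} \<subseteq> {..m}"
    using assms(1) by auto
  then show "finite {card C |C. C \<in> Chains r \<and> finite C \<and> (\<forall>c\<in>C. (c, x) \<in> r \<and> c \<noteq> x)}"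
    using finite_subset by blast
qed (use assms in auto)

lemma poset_rank_chain_poset:
  assumes "j < n"
  shows "poset_rank (chain_poset n) j = j"
proof (rule poset_rank_eqI[where C = "{..<j}"])
  show "card C \<le> j" if "\<forall>c\<in>C. (c, j) \<in> chain_poset n \<and> c \<noteq> j" for C
    using \<open>\<forall>c\<in>C. _\<close> card_mono[of "{..<j}" C] by (force simp: chain_poset_def)
qed (use assms in \<open>auto simp: chain_poset_def Chains_def\<close>)

text \<open>Strictly below the hull of \<open>A\<close> lie hulls of nonempty proper subsets, and in
  a chain their sizes are distinct. Vertices get rank 0 because the empty face is removed.\<close>

lemma poset_rank_PCP_minus:
  fixes A :: "(real ^ 'n) set"
  assumes A: "A \<in> cross_faces"
  shows "poset_rank PCP_minus (convex hull A) = card A - 1"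
proof -
  note finA = cross_facesD(1)[OF A]
  obtain xs where xs: "distinct xs" "set xs = A" using finite_distinct_list[OF finA] by metis
  then have len: "length xs = card A" using distinct_card by metis
  \<comment> \<open>Initial segments of an enumeration of \<open>A\<close> give a chain attaining
    the bound.\<close>
  define B where "B k = set (take k xs)" for k
  have B: "B k \<in> cross_faces" "card (B k) = k" "B k \<subseteq> A" if "k \<in> {1..<card A}" for k
  proof -
    show "B k \<subseteq> A" using set_take_subset[of k xs] xs by (simp add: B_def)
    show "card (B k) = k" using distinct_card[OF distinct_take[OF xs(1)], of k] len that by (simp add: B_def)
    then have "B k \<noteq> {}" using that by auto
    then show "B k \<in> cross_faces" using cross_faces_subset[OF A \<open>B k \<subseteq> A\<close>] by simp
  qed
  have B_mono: "B k \<subseteq> B l" if "k \<le> l" for k l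
    using set_take_subset_set_take[OF that] by (simp add: B_def)
  let ?C = "(\<lambda>k. convex hull (B k)) ` {1..<card A}"
  show ?thesis
  proof (rule poset_rank_eqI[where C = ?C])
    fix C assume C: "C \<in> Chains PCP_minus" "finite C" "\<forall>c\<in>C. (c, convex hull A) \<in> PCP_minus \<and> c \<noteq> convex hull A"
    have face: "\<exists>B. B \<in> cross_faces \<and> B \<subset> A \<and> c = convex hull B" if "c \<in> C" for c
    proof -
      have "(c, convex hull A) \<in> PCP_minus" "c \<noteq> convex hull A" using C(3) \<open>c \<in> C\<close> by auto
      then show ?thesis unfolding PCP_minus_iff using cross_hull_eq_iff[OF A] by (metis psubsetI)
    qed
    \<comment> \<open>Reads the number of vertices off the face itself.\<close>
    let ?h = "\<lambda>c. card (c \<inter> cross_vertices)"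
    have "inj_on ?h C"
    proof (rule inj_onI)
      fix c c' assume c: "c \<in> C" "c' \<in> C" "?h c = ?h c'"
      obtain D D' where D: "D \<in> cross_faces" "c = convex hull D" "D' \<in> cross_faces" "c' = convex hull D'"
        using face c by metis
      have "card D = card D'" using c(3) D cross_facesD(3) by metis
      moreover have "D \<subseteq> D' \<or> D' \<subseteq> D"
        using C(1) c D PCP_minus_hull_iff unfolding Chains_def by blast
      ultimately show "c = c'" using D cross_facesD(1) card_subset_eq by metis
    qed
    moreover have "?h ` C \<subseteq> {1..<card A}"
    proof
      fix m assume "m \<in> ?h ` C"
      then obtain c where c: "c \<in> C" "m = ?h c" by blast
      obtain D where D: "D \<in> cross_faces" "D \<subset> A" "c = convex hull D" using face c(1) by metis
      then show "m \<in> {1..<card A}"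
        using c(2) cross_facesD[OF D(1)] psubset_card_mono[OF finA D(2)] by simp
    qed
    ultimately have "card C \<le> card {1..<card A}" by (intro card_inj_on_le[of ?h]) auto
    then show "card C \<le> card A - 1" by simp
  next
    show "?C \<in> Chains PCP_minus"
      unfolding Chains_def
    proof (intro CollectI ballI)
      fix c d assume "c \<in> ?C" "d \<in> ?C"
      then obtain k l where "k \<in> {1..<card A}" "c = convex hull (B k)" "l \<in> {1..<card A}" "d = convex hull (B l)"
        by auto
      then show "(c, d) \<in> PCP_minus \<or> (d, c) \<in> PCP_minus"
        using B(1) B_mono[of k l] B_mono[of l k] by (cases "k \<le> l") (auto simp: PCP_minus_hull_iff)
    qed
    show "\<forall>c\<in>?C. (c, convex hull A) \<in> PCP_minus \<and> c \<noteq> convex hull A"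
    proof
      fix c assume "c \<in> ?C"
      then obtain k where k: "k \<in> {1..<card A}" "c = convex hull (B k)" by blast
      then have "B k \<noteq> A" using B(2)[OF k(1)] by auto
      then show "(c, convex hull A) \<in> PCP_minus \<and> c \<noteq> convex hull A"
        using B[OF k(1)] k A by (simp add: PCP_minus_hull_iff cross_hull_eq_iff)
    qed
    have "inj_on (\<lambda>k. convex hull (B k)) {1..<card A}"
    proof (rule inj_onI)
      fix k l assume kl: "k \<in> {1..<card A}" "l \<in> {1..<card A}" "convex hull (B k) = convex hull (B l)"
      then have "B k = B l" using cross_hull_eq_iff[OF B(1)[OF kl(1)] B(1)[OF kl(2)]] by simp
      then have "card (B k) = card (B l)" by (rule arg_cong)
      then show "k = l" unfolding B(2)[OF kl(1)] B(2)[OF kl(2)] .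
    qed
    then show "card ?C = card A - 1" by (simp add: card_image)
  qed simp
qed

text \<open>Faces are nonempty, so the rank \<open>card A - 1\<close> is an honest difference: rank
  bounds become strict inequalities and the rank difference is stated additively.\<close>

lemma rees_product_iff:
  fixes F G :: "(real ^ 'n) set"
  shows "((F, i), (G, j)) \<in> rees_product PCP_minus (chain_poset n) \<longleftrightarrow>
    (\<exists>A B. A \<in> cross_faces \<and> B \<in> cross_faces \<and> A \<subseteq> B \<and> F = convex hull A \<and> G = convex hull B \<and>
       i \<le> j \<and> j < n \<and> i < card A \<and> j < card B \<and> j + card A \<le> i + card B)"
    (is "?L \<longleftrightarrow> ?R")
proof
  assume L: ?L
  then obtain A B where AB: "A \<in> cross_faces" "B \<in> cross_faces" "A \<subseteq> B" "F = convex hull A" "G = convex hull B"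
    unfolding rees_product_def PCP_minus_iff by auto
  have ij: "i \<le> j" "j < n" using L by (auto simp: rees_product_def chain_poset_def)
  have "card A > 0" "card B > 0" using AB cross_facesD by metis+
  then show ?R using L AB ij
    by (intro exI[of _ A] exI[of _ B])
      (auto simp: rees_product_def poset_rank_chain_poset poset_rank_PCP_minus of_nat_diff)
next
  assume ?R
  then obtain A B where AB: "A \<in> cross_faces" "B \<in> cross_faces" "A \<subseteq> B" "F = convex hull A" "G = convex hull B"
      "i \<le> j" "j < n" "i < card A" "j < card B" "j + card A \<le> i + card B" by blast
  then have "(i, j) \<in> chain_poset n" "(F, G) \<in> PCP_minus"
    by (auto simp: chain_poset_def PCP_minus_hull_iff)
  moreover have "i \<le> card A - 1" "j \<le> card B - 1" "int (card A - 1) = int (card A) - 1" "int (card B - 1) = int (card B) - 1"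
    using AB by auto
  ultimately show ?L using AB
    by (simp add: rees_product_def poset_rank_chain_poset poset_rank_PCP_minus of_nat_diff)
qed


section \<open>Nonzero integers as labels of the vertices\<close>

locale vertex_labelling =
  fixes e :: "int \<Rightarrow> 'n::finite" and n :: nat
  assumes n_def: "n = CARD('n)" and bij_e: "bij_betw e {1..int n} UNIV"
begin

definition vertex :: "int \<Rightarrow> real ^ 'n" where
  "vertex a = (if 0 < a then axis (e a) 1 else - axis (e (- a)) 1)"

definition letters :: "int set" where "letters = {a. \<bar>a\<bar> \<in> {1..int n}}"

lemma vertex_uminus: "a \<in> letters \<Longrightarrow> vertex (- a) = - vertex a"
  by (auto simp: vertex_def letters_def)

lemma inj_vertex: "inj_on vertex letters"
proof (rule inj_onI)
  fix a b assume ab: "a \<in> letters" "b \<in> letters" "vertex a = vertex b"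
  have e: "x = y" if "e x = e y" "x \<in> {1..int n}" "y \<in> {1..int n}" for x y
    using that bij_e by (auto simp: bij_betw_def dest: inj_onD)
  show "a = b"
  proof (cases "0 < a"; cases "0 < b")
    assume "0 < a" "0 < b"
    then show ?thesis using ab e[of a b] by (auto simp: vertex_def letters_def axis_eq_axis)
  next
    assume "\<not> 0 < a" "\<not> 0 < b"
    then show ?thesis using ab e[of "-a" "-b"] by (auto simp: vertex_def letters_def axis_eq_axis)
  next
    assume "0 < a" "\<not> 0 < b"
    then show ?thesis using ab axis_neq_uminus_axis by (auto simp: vertex_def)
  next
    assume "\<not> 0 < a" "0 < b"
    then show ?thesis using ab axis_neq_uminus_axis by (metis vertex_def)
  qed
qed

lemma vertex_image: "vertex ` letters = cross_vertices"
proof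
  show "vertex ` letters \<subseteq> cross_vertices" by (auto simp: vertex_def cross_vertices_def)
  show "cross_vertices \<subseteq> vertex ` letters"
  proof
    fix v :: "real ^ 'n" assume "v \<in> cross_vertices"
    then obtain i where i: "v = axis i 1 \<or> v = - axis i 1" by (auto simp: cross_vertices_def)
    obtain a where a: "a \<in> {1..int n}" "e a = i" using bij_e by (metis UNIV_I bij_betw_def imageE)
    from i show "v \<in> vertex ` letters"
    proof
      assume "v = axis i 1"
      then show ?thesis using a by (intro image_eqI[of _ _ a]) (auto simp: vertex_def letters_def)
    next
      assume "v = - axis i 1"
      then show ?thesis using a by (intro image_eqI[of _ _ "- a"]) (auto simp: vertex_def letters_def)
    qed
  qed
qed

text \<open>\<open>inj_on abs\<close> forbids both signs of one label, the integer form of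
  antipode-freeness.\<close>

definition signed_sets :: "int set set" where
  "signed_sets = {A. A \<subseteq> letters \<and> inj_on abs A \<and> A \<noteq> {}}"

lemma inj_on_abs_iff: "0 \<notin> A \<Longrightarrow> inj_on abs A \<longleftrightarrow> antipode_free (A :: int set)"
proof
  assume "0 \<notin> A" "inj_on abs A"
  then show "antipode_free A" unfolding antipode_free_def
    by (metis abs_minus inj_onD equal_neg_zero)
next
  assume "antipode_free A"
  then show "inj_on abs A" unfolding antipode_free_def
    by (intro inj_onI) (metis abs_eq_iff)
qed

lemma signed_sets_iff: "A \<in> signed_sets \<longleftrightarrow> A \<subseteq> letters \<and> vertex ` A \<in> cross_faces"
proof (cases "A \<subseteq> letters")
  case True
  then have "0 \<notin> A" by (auto simp: letters_def)
  have neg: "- a \<in> letters" if "a \<in> letters" for a using that by (simp add: letters_def)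
  have "- vertex a \<in> vertex ` A \<longleftrightarrow> - a \<in> A" if "a \<in> A" for a
    using inj_on_image_mem_iff[OF inj_vertex _ True, of "- a"] vertex_uminus[of a] neg[of a] that True by auto
  then have "antipode_free (vertex ` A) \<longleftrightarrow> antipode_free A" by (auto simp: antipode_free_def)
  moreover have "vertex ` A \<subseteq> cross_vertices" using True vertex_image by blast
  ultimately show ?thesis using True \<open>0 \<notin> A\<close> by (auto simp: signed_sets_def cross_faces_def inj_on_abs_iff)
qed (auto simp: signed_sets_def)

lemma cross_faces_vertex:
  assumes "B \<in> cross_faces"
  obtains A where "A \<in> signed_sets" "B = vertex ` A"
proof
  let ?A = "{a \<in> letters. vertex a \<in> B}"
  show "B = vertex ` ?A" using assms vertex_image by (auto simp: cross_faces_def)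
  then show "?A \<in> signed_sets" using assms unfolding signed_sets_iff by auto
qed

lemma signed_setsD:
  assumes "A \<in> signed_sets"
  shows "vertex ` A \<in> cross_faces" "card (vertex ` A) = card A" "finite A" "card (abs ` A) = card A"
    "card A \<le> n" "abs ` A \<subseteq> {1..int n}"
proof -
  show "vertex ` A \<in> cross_faces" using assms by (simp add: signed_sets_iff)
  show "card (vertex ` A) = card A"
    using assms inj_vertex by (auto simp: signed_sets_def intro: card_image inj_on_subset)
  show abs: "card (abs ` A) = card A" "abs ` A \<subseteq> {1..int n}"
    using assms by (auto simp: signed_sets_def letters_def card_image)
  then show "card A \<le> n" using card_mono[OF _ abs(2)] by simp
  show "finite A" using assms abs(2) unfolding signed_sets_def
    by (metis (mono_tags, lifting) finite_atLeastAtMost_int finite_imageD finite_subset mem_Collect_eq)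
qed

lemma vertex_image_subset_iff:
  "A \<in> signed_sets \<Longrightarrow> B \<in> signed_sets \<Longrightarrow> vertex ` A \<subseteq> vertex ` B \<longleftrightarrow> A \<subseteq> B"
  using inj_on_image_subset_iff[OF inj_vertex] by (auto simp: signed_sets_def)

definition rees :: "((real ^ 'n) set \<times> nat) rel" where
  "rees = rees_product PCP_minus (chain_poset n)"

definition point :: "int set \<times> nat \<Rightarrow> (real ^ 'n) set \<times> nat" where
  "point p = (convex hull (vertex ` fst p), snd p)"

text \<open>\<open>i < card A\<close> is the rank condition; together with
  \<open>card A \<le> n\<close> it also keeps \<open>i\<close> inside the chain poset.\<close>

definition points :: "(int set \<times> nat) set" where
  "points = {(A, i). A \<in> signed_sets \<and> i < card A}"

lemma inj_point: "inj_on point points"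
proof (rule inj_onI)
  fix p q assume pq: "p \<in> points" "q \<in> points" "point p = point q"
  then have signed: "fst p \<in> signed_sets" "fst q \<in> signed_sets" by (auto simp: points_def)
  have "vertex ` fst p = vertex ` fst q"
    using cross_hull_eq_iff[OF signed_setsD(1)[OF signed(1)] signed_setsD(1)[OF signed(2)]] pq(3)
    by (simp add: point_def)
  then have "fst p = fst q" using vertex_image_subset_iff[of "fst p" "fst q"] vertex_image_subset_iff[of "fst q" "fst p"] signed
    by simp
  then show "p = q" using pq(3) by (simp add: point_def prod_eq_iff)
qed

lemma rees_iff:
  "(x, y) \<in> rees \<longleftrightarrow> (\<exists>A i B j. (A, i) \<in> points \<and> (B, j) \<in> points \<and> x = point (A, i) \<and> y = point (B, j) \<and>
     A \<subseteq> B \<and> i \<le> j \<and> j + card A \<le> i + card B)" (is "?L \<longleftrightarrow> ?R")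
proof
  assume ?L
  moreover obtain F i G j where xy: "x = (F, i)" "y = (G, j)" by fastforce
  ultimately obtain A B where AB: "A \<in> cross_faces" "B \<in> cross_faces" "A \<subseteq> B" "F = convex hull A" "G = convex hull B"
      "i \<le> j" "j < n" "i < card A" "j < card B" "j + card A \<le> i + card B"
    unfolding rees_def xy rees_product_iff by blast
  obtain A' where A': "A' \<in> signed_sets" "A = vertex ` A'" using cross_faces_vertex[OF AB(1)] .
  obtain B' where B': "B' \<in> signed_sets" "B = vertex ` B'" using cross_faces_vertex[OF AB(2)] .
  have "A' \<subseteq> B'" using AB(3) A' B' vertex_image_subset_iff by blast
  moreover have "card A = card A'" "card B = card B'" using A' B' signed_setsD by auto
  ultimately show ?R using AB A' B' xy
    by (intro exI[of _ A'] exI[of _ i] exI[of _ B'] exI[of _ j]) (auto simp: points_def point_def)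
next
  assume ?R
  then obtain A i B j where R: "(A, i) \<in> points" "(B, j) \<in> points" "x = point (A, i)" "y = point (B, j)"
     "A \<subseteq> B" "i \<le> j" "j + card A \<le> i + card B" by blast
  then have "A \<in> signed_sets" "B \<in> signed_sets" by (auto simp: points_def)
  note A = signed_setsD[OF this(1)] and B = signed_setsD[OF this(2)]
  have "vertex ` A \<subseteq> vertex ` B" using R by auto
  then show ?L unfolding rees_def R(3,4) point_def fst_conv snd_conv rees_product_iff
    using A B R by (intro exI[of _ "vertex ` A"] exI[of _ "vertex ` B"]) (auto simp: points_def)
qed

end

section \<open>Maximal chains of the Rees product\<close>

lemma trans_word_less: "trans word_less"
  unfolding word_less_def by (rule lexord_transI) (auto simp: trans_def)

lemma irrefl_word_less: "irrefl word_less"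
  unfolding word_less_def irrefl_def by (intro allI lexord_irreflexive) auto

text \<open>With \<open>K = {}\<close> leastness needs no ascents: two different words with equal
  levels would each be smaller than the other.\<close>

lemma words_eqI:
  assumes w: "w \<in> words S" "w' \<in> words S" and lev: "\<And>l. l < card S \<Longrightarrow> word_level w l = word_level w' l"
  shows "w = w'"
proof (rule ccontr)
  assume "w \<noteq> w'"
  then have "(w, w') \<in> word_less" "(w', w) \<in> word_less"
    using word_asc_least[OF w, of "{}"] word_asc_least[OF w(2,1), of "{}"] lev by auto
  moreover have "trans word_less" "irrefl word_less" by (fact trans_word_less irrefl_word_less)+
  ultimately show False by (meson irrefl_def transD)
qed

lemma card_word_level:
  assumes w: "w \<in> words S" and k: "k < card S"
  shows "card (fst (word_level w k)) = Suc k" "inj_on abs (fst (word_level w k))"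
proof -
  have len: "length w = card S" using w by (simp add: words_def)
  have d: "distinct (map (abs \<circ> fst) (take (Suc k) w))"
    using words_distinct[OF w] by (simp add: take_map[symmetric] comp_def)
  then have "distinct (map fst (take (Suc k) w))" by (metis distinct_map map_map)
  then show "card (fst (word_level w k)) = Suc k"
    using distinct_card[of "map fst (take (Suc k) w)"] len k by (simp add: word_level_def)
  have "distinct (map abs (map fst (take (Suc k) w)))" using d by simp
  then show "inj_on abs (fst (word_level w k))" unfolding distinct_map word_level_def by simp
qed

lemma word_level_fst_mono: "k \<le> l \<Longrightarrow> fst (word_level w k) \<subseteq> fst (word_level w l)"
  by (auto simp: word_level_fst)

lemma word_level_snd_add:
  assumes w: "w \<in> words S" and kl: "k \<le> l" "l < card S"
  shows "snd (word_level w k) \<le> snd (word_level w l)" "snd (word_level w l) \<le> snd (word_level w k) + (l - k)"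
proof -
  have len: "length w = card S" using w by (simp add: words_def)
  have un: "{..l} = {..k} \<union> {k<..l}" using kl by auto
  have split: "(\<Sum>i\<le>l. snd (w ! i)) = (\<Sum>i\<le>k. snd (w ! i)) + (\<Sum>i\<in>{k<..l}. snd (w ! i))"
    unfolding un by (subst sum.union_disjoint) auto
  have "(\<Sum>i\<in>{k<..l}. snd (w ! i)) \<le> (\<Sum>i\<in>{k<..l}. 1)"
    using words_nth(1)[OF w] len kl by (intro sum_mono) auto
  then have "(\<Sum>i\<in>{k<..l}. snd (w ! i)) \<le> l - k" by simp
  then show "snd (word_level w k) \<le> snd (word_level w l)" "snd (word_level w l) \<le> snd (word_level w k) + (l - k)"
    using split kl len by (auto simp: word_level_snd)
qed

lemma word_level_snd_0:
  assumes w: "w \<in> words S" and S: "0 < card S"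
  shows "snd (word_level w 0) = 0"
proof -
  have "w \<noteq> []" "snd (hd w) = 0" using w S by (auto simp: words_def)
  then show ?thesis by (cases w) (auto simp: word_level_def)
qed

context vertex_labelling
begin

abbreviation W :: "(int \<times> nat) list set" where "W \<equiv> words {1..int n}"

lemma n_pos: "0 < n" by (simp add: n_def)

lemma word_level_points:
  assumes w: "w \<in> W" and k: "k < n"
  shows "word_level w k \<in> points"
proof -
  have len: "length w = n" using w by (simp add: words_def)
  have card: "card (fst (word_level w k)) = Suc k" and inj: "inj_on abs (fst (word_level w k))"
    using card_word_level[OF w] k by auto
  have "fst (word_level w k) \<subseteq> letters"
    using words_nth(2)[OF w] len by (auto simp: word_level_fst letters_def)
  moreover have "fst (word_level w k) \<noteq> {}" using card by auto
  moreover have "snd (word_level w k) \<le> k"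
    using word_level_snd_add(2)[OF w, of 0 k] word_level_snd_0[OF w] k n_pos by simp
  ultimately show ?thesis using card inj by (auto simp: points_def signed_sets_def case_prod_beta)
qed

lemma point_rees_iff:
  assumes "p \<in> points" "q \<in> points"
  shows "(point p, point q) \<in> rees \<longleftrightarrow>
    fst p \<subseteq> fst q \<and> snd p \<le> snd q \<and> snd q + card (fst p) \<le> snd p + card (fst q)"
proof
  assume "(point p, point q) \<in> rees"
  then obtain A i B j where *: "(A, i) \<in> points" "(B, j) \<in> points" "point p = point (A, i)" "point q = point (B, j)"
     "A \<subseteq> B" "i \<le> j" "j + card A \<le> i + card B" unfolding rees_iff by blast
  then have "p = (A, i)" "q = (B, j)" using assms inj_onD[OF inj_point] by metis+
  then show "fst p \<subseteq> fst q \<and> snd p \<le> snd q \<and> snd q + card (fst p) \<le> snd p + card (fst q)" using * by simp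
next
  assume "fst p \<subseteq> fst q \<and> snd p \<le> snd q \<and> snd q + card (fst p) \<le> snd p + card (fst q)"
  then show "(point p, point q) \<in> rees" unfolding rees_iff using assms
    by (intro exI[of _ "fst p"] exI[of _ "snd p"] exI[of _ "fst q"] exI[of _ "snd q"]) auto
qed

definition vtx :: "(int \<times> nat) list \<Rightarrow> nat \<Rightarrow> (real ^ 'n) set \<times> nat" where
  "vtx w k = point (word_level w k)"

definition chain :: "(int \<times> nat) list \<Rightarrow> ((real ^ 'n) set \<times> nat) set" where
  "chain w = vtx w ` {..<n}"

lemma vtx_eq_iff:
  assumes "w \<in> W" "w' \<in> W" "k < n" "l < n"
  shows "vtx w k = vtx w' l \<longleftrightarrow> k = l \<and> word_level w k = word_level w' l"
proof -
  have "vtx w k = vtx w' l \<longleftrightarrow> word_level w k = word_level w' l"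
    unfolding vtx_def using inj_on_eq_iff[OF inj_point] word_level_points assms by blast
  moreover have "k = l" if "word_level w k = word_level w' l"
    using card_word_level(1)[OF assms(1), of k] card_word_level(1)[OF assms(2), of l] assms that by simp
  ultimately show ?thesis by blast
qed

lemma vtx_rees_iff:
  assumes "w \<in> W" "k < n" "l < n"
  shows "(vtx w k, vtx w l) \<in> rees \<longleftrightarrow> k \<le> l"
proof -
  have card: "card (fst (word_level w k)) = Suc k" "card (fst (word_level w l)) = Suc l"
    using card_word_level(1)[OF assms(1)] assms by auto
  show ?thesis
  proof
    assume "k \<le> l"
    then show "(vtx w k, vtx w l) \<in> rees"
      unfolding vtx_def using assms word_level_points card word_level_fst_mono word_level_snd_add[OF assms(1), of k l]
      by (subst point_rees_iff) auto
  next
    assume "(vtx w k, vtx w l) \<in> rees"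
    then have "fst (word_level w k) \<subseteq> fst (word_level w l)"
      unfolding vtx_def using assms word_level_points by (subst (asm) point_rees_iff) auto
    moreover have "finite (fst (word_level w l))" using card by (metis card.infinite nat.distinct(1))
    ultimately have "card (fst (word_level w k)) \<le> card (fst (word_level w l))" by (rule card_mono[rotated])
    then show "k \<le> l" using card by simp
  qed
qed

lemma inj_vtx: "w \<in> W \<Longrightarrow> inj_on (vtx w) {..<n}"
  by (auto intro!: inj_onI simp: vtx_eq_iff)

lemma chain_simplex:
  assumes "w \<in> W"
  shows "chain w \<in> simplices rees (int n - 1)"
proof -
  have "chain w \<in> Chains rees"
    using vtx_rees_iff[OF assms] by (auto simp: chain_def Chains_def)
  moreover have "card (chain w) = n" unfolding chain_def using inj_vtx[OF assms] by (simp add: card_image)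
  ultimately show ?thesis by (simp add: simplices_def chain_def)
qed

text \<open>The size of a face tells its position in the chain, so the set determines every
  level.\<close>

lemma inj_chain: "inj_on chain W"
proof (rule inj_onI)
  fix w w' assume w: "w \<in> W" "w' \<in> W" and eq: "chain w = chain w'"
  show "w = w'"
  proof (rule words_eqI[OF w])
    fix l assume "l < card {1..int n}"
    then have l: "l < n" by simp
    then have "vtx w l \<in> chain w'" using eq by (auto simp: chain_def)
    then obtain l' where "l' < n" "vtx w l = vtx w' l'" by (auto simp: chain_def)
    then show "word_level w l = word_level w' l" using vtx_eq_iff[OF w l] by auto
  qed
qed

text \<open>Comparable elements with faces of equal size have equal faces, and the Rees inequality
  then forces equal heights. So face sizes separate the members of a chain.\<close>

lemma Chains_rees_rank:
  assumes c: "c \<in> Chains rees"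
  obtains P where "P \<subseteq> points" "c = point ` P" "inj_on (\<lambda>p. card (fst p)) P"
    "(\<lambda>p. card (fst p)) ` P \<subseteq> {1..n}" "\<And>p q. p \<in> P \<Longrightarrow> q \<in> P \<Longrightarrow> (point p, point q) \<in> rees \<or> (point q, point p) \<in> rees"
proof
  let ?P = "{p \<in> points. point p \<in> c}"
  show sub: "?P \<subseteq> points" by blast
  have "x \<in> point ` ?P" if "x \<in> c" for x
  proof -
    have "(x, x) \<in> rees" using c \<open>x \<in> c\<close> by (auto simp: Chains_def)
    then show ?thesis unfolding rees_iff using \<open>x \<in> c\<close> by blast
  qed
  then show "c = point ` ?P" by blast
  show cmp: "\<And>p q. p \<in> ?P \<Longrightarrow> q \<in> ?P \<Longrightarrow> (point p, point q) \<in> rees \<or> (point q, point p) \<in> rees"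
    using c by (auto simp: Chains_def)
  have eq: "p = q" if "p \<in> points" "q \<in> points" "(point p, point q) \<in> rees" "card (fst p) = card (fst q)" for p q
  proof -
    have "fst q \<in> signed_sets" using \<open>q \<in> points\<close> by (auto simp: points_def)
    then have "finite (fst q)" by (rule signed_setsD)
    moreover have "fst p \<subseteq> fst q" "snd p \<le> snd q" "snd q \<le> snd p"
      using point_rees_iff[OF that(1,2)] that(3,4) by auto
    ultimately show ?thesis using card_subset_eq that(4) by (metis order_antisym prod_eq_iff)
  qed
  show "inj_on (\<lambda>p. card (fst p)) ?P"
  proof (rule inj_onI)
    fix p q assume "p \<in> ?P" "q \<in> ?P" "card (fst p) = card (fst q)"
    then show "p = q" using cmp[of p q] eq[of p q] eq[of q p] by auto
  qed
  show "(\<lambda>p. card (fst p)) ` ?P \<subseteq> {1..n}"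
  proof
    fix m assume "m \<in> (\<lambda>p. card (fst p)) ` ?P"
    then obtain p where p: "p \<in> points" "m = card (fst p)" by blast
    then have "fst p \<in> signed_sets" "0 < m" by (auto simp: points_def)
    then show "m \<in> {1..n}" using signed_setsD(5) p by auto
  qed
qed

text \<open>Consecutive levels differ by one vertex and a height increase of 0 or 1: these form the
  next letter. Absolute values and the first step are left to the user of the lemma.\<close>

lemma word_of_levels:
  assumes q: "\<And>k. k < m \<Longrightarrow> q k \<in> points \<and> card (fst (q k)) = Suc k"
    and rel: "\<And>k. Suc k < m \<Longrightarrow> (point (q k), point (q (Suc k))) \<in> rees"
  shows "\<exists>w. length w = m \<and> snd ` set w \<subseteq> {0, 1} \<and> (\<forall>k<m. word_level w k = q k)"
  using assms
proof (induction m)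
  case 0
  then show ?case by simp
next
  case (Suc m)
  then obtain w where w: "length w = m" "snd ` set w \<subseteq> {0, 1}" "\<forall>k<m. word_level w k = q k" by force
  have "\<exists>a s. fst (q m) = insert a (fst ` set w) \<and> snd (q m) = sum_list (map snd w) + s \<and> s \<in> {0, 1}"
  proof (cases m)
    case 0
    \<comment> \<open>The first height is below the face size 1, so the first step is 0.\<close>
    then have "card (fst (q 0)) = 1" "snd (q 0) < card (fst (q 0))" using Suc.prems(1)[of 0] by (auto simp: points_def)
    then obtain a where "fst (q 0) = {a}" "snd (q 0) = 0" by (metis card_1_singletonE less_one)
    then show ?thesis using 0 w by auto
  next
    case (Suc l)
    have lev: "q l = (fst ` set w, sum_list (map snd w))" using w Suc by (auto simp: word_level_def)
    have r: "fst (q l) \<subseteq> fst (q m)" "snd (q l) \<le> snd (q m)" "snd (q m) \<le> snd (q l) + 1"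
      using Suc.prems(2)[of l] Suc point_rees_iff[of "q l" "q m"] Suc.prems(1)[of l] Suc.prems(1)[of m] by auto
    have c: "card (fst (q l)) = m" "card (fst (q m)) = Suc m" using Suc.prems(1)[of l] Suc.prems(1)[of m] Suc by auto
    then have fin: "finite (fst (q l))" "finite (fst (q m))" using Suc by (metis card.infinite nat.distinct(1))+
    have "card (fst (q m) - fst (q l)) = 1" using c r fin by (simp add: card_Diff_subset)
    then obtain a where "fst (q m) - fst (q l) = {a}" by (metis card_1_singletonE)
    then have "fst (q m) = insert a (fst (q l))" using r by blast
    moreover obtain s where "snd (q m) = snd (q l) + s" "s \<in> {0, 1}" using r(2,3)
      by (metis add_le_cancel_left insertCI le_Suc_ex le_zero_eq less_one order_le_less)
    ultimately show ?thesis using lev by auto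
  qed
  then obtain a s where as: "fst (q m) = insert a (fst ` set w)" "snd (q m) = sum_list (map snd w) + s" "s \<in> {0, 1}"
    by blast
  have "word_level (w @ [(a, s)]) k = q k" if "k < Suc m" for k
  proof (cases "k < m")
    case True
    then show ?thesis using w by (simp add: word_level_def)
  next
    case False
    then have "k = m" using that by simp
    then show ?thesis using w(1) as by (simp add: word_level_def prod_eq_iff)
  qed
  then show ?case using w as by (intro exI[of _ "w @ [(a, s)]"]) auto
qed

text \<open>The \<open>n\<close> members have distinct face sizes among 1 to \<open>n\<close>, so
  each size occurs and the members form the levels of a word.\<close>

lemma simplex_chain:
  assumes c: "c \<in> simplices rees (int n - 1)"
  shows "c \<in> chain ` W"
proof -
  have "c \<in> Chains rees" "finite c" "card c = n" using c by (auto simp: simplices_def)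
  obtain P where P: "P \<subseteq> points" "c = point ` P" "inj_on (\<lambda>p. card (fst p)) P" "(\<lambda>p. card (fst p)) ` P \<subseteq> {1..n}"
    "\<And>p q. p \<in> P \<Longrightarrow> q \<in> P \<Longrightarrow> (point p, point q) \<in> rees \<or> (point q, point p) \<in> rees"
    using Chains_rees_rank[OF \<open>c \<in> Chains rees\<close>] by metis
  have "card P = n" using \<open>card c = n\<close> P card_image[OF inj_on_subset[OF inj_point P(1)]] by simp
  then have "(\<lambda>p. card (fst p)) ` P = {1..n}"
    using P(3,4) by (intro card_subset_eq) (auto simp: card_image)
  then have "\<forall>k<n. \<exists>p\<in>P. card (fst p) = Suc k" by (metis (no_types, lifting) Suc_leI atLeastAtMost_iff imageE le_add1 plus_1_eq_Suc)
  then obtain q where q: "\<And>k. k < n \<Longrightarrow> q k \<in> P \<and> card (fst (q k)) = Suc k" by metis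
  have rel: "(point (q k), point (q (Suc k))) \<in> rees" if "Suc k < n" for k
  proof (rule ccontr)
    assume "\<not> ?thesis"
    then have "(point (q (Suc k)), point (q k)) \<in> rees" using P(5) q \<open>Suc k < n\<close> by (metis Suc_lessD)
    then have "fst (q (Suc k)) \<subseteq> fst (q k)" using point_rees_iff q P(1) \<open>Suc k < n\<close> by (metis Suc_lessD subsetD)
    moreover have "card (fst (q k)) = Suc k" "card (fst (q (Suc k))) = Suc (Suc k)" using q \<open>Suc k < n\<close> by auto
    moreover from this have "finite (fst (q k))" by (metis card.infinite nat.distinct(1))
    ultimately show False using card_mono[of "fst (q k)" "fst (q (Suc k))"] by simp
  qed
  have "\<exists>w. length w = n \<and> snd ` set w \<subseteq> {0, 1} \<and> (\<forall>k<n. word_level w k = q k)"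
    by (rule word_of_levels) (use q P(1) rel in auto)
  then obtain w where w: "length w = n" "snd ` set w \<subseteq> {0, 1}" "\<forall>k<n. word_level w k = q k"
    by blast
  have "word_level w (n - 1) = q (n - 1)" using w n_pos by simp
  moreover have "fst (word_level w (n - 1)) = fst ` set w" using w(1) n_pos by (simp add: word_level_def)
  ultimately have last: "fst ` set w = fst (q (n - 1))" by simp
  have "q (n - 1) \<in> points" "card (fst (q (n - 1))) = n" using q[of "n - 1"] n_pos P(1) by auto
  then have A: "fst (q (n - 1)) \<in> signed_sets" "card (fst (q (n - 1))) = n" by (auto simp: points_def case_prod_beta)
  have "abs ` fst (q (n - 1)) = {1..int n}"
    using signed_setsD(4,6)[OF A(1)] A(2) by (intro card_subset_eq) auto
  then have abs: "(\<lambda>x. \<bar>fst x\<bar>) ` set w = {1..int n}" using last by (metis image_image)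
  have "q 0 \<in> points" "card (fst (q 0)) = 1" using q[of 0] n_pos P(1) by auto
  then have "snd (word_level w 0) = 0" using w(3) n_pos by (auto simp: points_def case_prod_beta)
  then have "snd (hd w) = 0" using w(1) n_pos by (cases w) (auto simp: word_level_def)
  then have "w \<in> W" using w abs by (simp add: words_def)
  moreover have "c = chain w"
  proof -
    have "q ` {..<n} = P"
    proof (rule card_subset_eq)
      show "finite P" using \<open>card P = n\<close> n_pos by (metis card.infinite less_irrefl)
      show "q ` {..<n} \<subseteq> P" using q by auto
      have "inj_on q {..<n}" using q by (metis inj_onI lessThan_iff nat.inject)
      then show "card (q ` {..<n}) = card P" using \<open>card P = n\<close> by (simp add: card_image)
    qed
    then have "c = (\<lambda>k. point (q k)) ` {..<n}" using P(2) by (metis image_image)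
    also have "\<dots> = chain w" unfolding chain_def vtx_def using w(3) by (intro image_cong) auto
    finally show ?thesis .
  qed
  ultimately show ?thesis by blast
qed

lemma simplices_eq: "simplices rees (int n - 1) = chain ` W"
  using simplex_chain chain_simplex by blast

lemma simplices_top: "simplices rees (int n) = {}"
proof (rule ccontr)
  assume "simplices rees (int n) \<noteq> {}"
  then obtain c where c: "c \<in> Chains rees" "card c = Suc n" by (force simp: simplices_def)
  obtain P where P: "P \<subseteq> points" "c = point ` P" "inj_on (\<lambda>p. card (fst p)) P" "(\<lambda>p. card (fst p)) ` P \<subseteq> {1..n}"
    using Chains_rees_rank[OF c(1)] by metis
  have "card c = card P" using P card_image[OF inj_on_subset[OF inj_point P(1)]] by simp
  also have "\<dots> \<le> card {1..n}" using P by (intro card_inj_on_le) auto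
  finally show False using c by simp
qed

end

section \<open>The boundary map in terms of words\<close>

context vertex_labelling
begin

sublocale ascent_system W n word_level word_less word_asc
proof unfold_locales
  show "finite W" by (rule finite_words) simp
  show "trans word_less" "irrefl word_less" by (fact trans_word_less irrefl_word_less)+
  show "(w, w') \<in> word_less"
    if "w \<in> W" "K \<subseteq> {..<n}" "\<And>k. k \<in> K \<Longrightarrow> word_asc k w" "w' \<in> level_system.fibre W n word_level K w" "w' \<noteq> w"
    for K w w'
    using that word_asc_least[of w "{1..int n}" w' K] by (simp add: level_system.fibre_def)
  show "\<exists>w'\<in>level_system.fibre W n word_level {k} w. word_asc k w'" if w: "w \<in> W" and k: "k < n" for k w
  proof -
    obtain w' where "w' \<in> W" "\<And>l. l < card {1..int n} \<Longrightarrow> l \<noteq> k \<Longrightarrow> word_level w' l = word_level w l" "word_asc k w'"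
      using word_asc_exists[OF w, of k] k by auto
    then show ?thesis by (intro bexI[of _ w']) (auto simp: level_system.fibre_def)
  qed
qed

definition facet :: "(int \<times> nat) list \<Rightarrow> nat \<Rightarrow> ((real ^ 'n) set \<times> nat) set" where
  "facet w k = chain w - {vtx w k}"

lemma facet_eq: "w \<in> W \<Longrightarrow> k < n \<Longrightarrow> facet w k = vtx w ` ({..<n} - {k})"
  using inj_on_image_set_diff[OF inj_vtx, of w "{..<n}" "{k}"] by (simp add: facet_def chain_def)

lemma facet_eq_iff:
  assumes w: "w \<in> W" "w' \<in> W" and k: "k < n" "k' < n"
  shows "facet w k = facet w' k' \<longleftrightarrow> k = k' \<and> w \<in> fibre {k'} w'"
proof
  assume eq: "facet w k = facet w' k'"
  have l: "l \<noteq> k' \<and> word_level w l = word_level w' l" if "l < n" "l \<noteq> k" for l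
  proof -
    have "vtx w l \<in> vtx w' ` ({..<n} - {k'})"
      using eq \<open>l < n\<close> \<open>l \<noteq> k\<close> facet_eq[OF w(1) k(1)] facet_eq[OF w(2) k(2)] by auto
    then obtain l' where "l' < n" "l' \<noteq> k'" "vtx w l = vtx w' l'" by auto
    then show ?thesis using vtx_eq_iff[OF w \<open>l < n\<close>, of l'] by auto
  qed
  \<comment> \<open>Otherwise \<open>k'\<close> itself could be taken for the index in
    \<open>l\<close>.\<close>
  then have "k = k'" using k by metis
  then show "k = k' \<and> w \<in> fibre {k'} w'" using l w by (auto simp: fibre_def)
next
  assume "k = k' \<and> w \<in> fibre {k'} w'"
  then show "facet w k = facet w' k'"
    using facet_eq[OF w(1) k(1)] facet_eq[OF w(2) k(2)] by (auto simp: fibre_def vtx_def)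
qed

lemma boundary_rees:
  assumes f: "{c. f c \<noteq> 0} \<subseteq> chain ` W"
  shows "boundary rees f d = (\<Sum>w\<in>W. \<Sum>k | k < n \<and> facet w k = d. (-1) ^ k * f (chain w))"
proof -
  define G where "G c = (\<Sum>x | x \<in> c \<and> c - {x} = d. (-1) ^ card {y \<in> c. (y, x) \<in> rees \<and> y \<noteq> x} * f c)" for c
  have "boundary rees f d = (\<Sum>c | f c \<noteq> 0. G c)" by (simp add: boundary_def G_def)
  also have "\<dots> = sum G (chain ` W)"
    by (rule sum.mono_neutral_left) (use f fin in \<open>auto simp: G_def\<close>)
  also have "\<dots> = (\<Sum>w\<in>W. G (chain w))" by (simp add: sum.reindex[OF inj_chain])
  also have "\<dots> = (\<Sum>w\<in>W. \<Sum>k | k < n \<and> facet w k = d. (-1) ^ k * f (chain w))"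
  proof (rule sum.cong[OF refl])
    fix w assume w: "w \<in> W"
    have "{x. x \<in> chain w \<and> chain w - {x} = d} = vtx w ` {k. k < n \<and> facet w k = d}"
    proof
      show "{x. x \<in> chain w \<and> chain w - {x} = d} \<subseteq> vtx w ` {k. k < n \<and> facet w k = d}"
      proof
        fix x assume x: "x \<in> {x. x \<in> chain w \<and> chain w - {x} = d}"
        then obtain k where "k < n" "x = vtx w k" by (auto simp: chain_def)
        then show "x \<in> vtx w ` {k. k < n \<and> facet w k = d}" using x by (simp add: facet_def)
      qed
      show "vtx w ` {k. k < n \<and> facet w k = d} \<subseteq> {x. x \<in> chain w \<and> chain w - {x} = d}"
      proof (rule image_subsetI)
        fix k assume "k \<in> {k. k < n \<and> facet w k = d}"
        then show "vtx w k \<in> {x. x \<in> chain w \<and> chain w - {x} = d}" by (simp add: facet_def chain_def)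
      qed
    qed
    moreover have "inj_on (vtx w) {k. k < n \<and> facet w k = d}"
      by (rule inj_on_subset[OF inj_vtx[OF w]]) auto
    \<comment> \<open>This cardinality is the exponent of the sign in
      \<open>boundary\<close>.\<close>
    moreover have "card {y \<in> chain w. (y, vtx w k) \<in> rees \<and> y \<noteq> vtx w k} = k" if k: "k < n" for k
    proof -
      have "{y \<in> chain w. (y, vtx w k) \<in> rees \<and> y \<noteq> vtx w k} = vtx w ` {..<k}"
        using vtx_rees_iff[OF w] vtx_eq_iff[OF w w] k by (auto simp: chain_def)
      moreover have "inj_on (vtx w) {..<k}" by (rule inj_on_subset[OF inj_vtx[OF w]]) (use k in auto)
      ultimately show ?thesis by (simp add: card_image)
    qed
    ultimately show "G (chain w) = (\<Sum>k | k < n \<and> facet w k = d. (-1) ^ k * f (chain w))"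
      unfolding G_def by (simp add: sum.reindex)
  qed
  finally show ?thesis .
qed

text \<open>The words sharing this facet all omit the same position, so their sign is common and
  factors out of the fibre sum.\<close>

lemma boundary_facet:
  assumes f: "{c. f c \<noteq> 0} \<subseteq> chain ` W" and w: "w \<in> W" "k < n"
  shows "boundary rees f (facet w k) = (-1) ^ k * (\<Sum>v\<in>fibre {k} w. f (chain v))"
proof -
  have "boundary rees f (facet w k) = (\<Sum>v\<in>W. \<Sum>l | l < n \<and> facet v l = facet w k. (-1) ^ l * f (chain v))"
    by (rule boundary_rees[OF f])
  also have "\<dots> = (\<Sum>v\<in>W. if v \<in> fibre {k} w then (-1) ^ k * f (chain v) else 0)"
  proof (rule sum.cong[OF refl])
    fix v assume v: "v \<in> W"
    have "{l. l < n \<and> facet v l = facet w k} = (if v \<in> fibre {k} w then {k} else {})"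
      using facet_eq_iff[OF v w(1) _ w(2)] w(2) by auto
    then show "(\<Sum>l | l < n \<and> facet v l = facet w k. (-1) ^ l * f (chain v)) =
      (if v \<in> fibre {k} w then (-1) ^ k * f (chain v) else 0)" by simp
  qed
  also have "\<dots> = (\<Sum>v\<in>fibre {k} w. (-1) ^ k * f (chain v))"
    using fin fibre_subset[of "{k}" w] by (simp add: sum.If_cases Int_absorb1)
  finally show ?thesis by (simp add: sum_distrib_left)
qed

text \<open>Outside the facets the boundary has coefficient 0. For \<open>n = 1\<close> the only
  facet is the empty simplex, and the condition is the augmentation.\<close>

lemma cycles_iff:
  "f \<in> cycles rees (int n - 1) \<longleftrightarrow>
     {c. f c \<noteq> 0} \<subseteq> chain ` W \<and> (\<forall>w\<in>W. \<forall>k<n. (\<Sum>v\<in>fibre {k} w. f (chain v)) = 0)"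
proof -
  have "(\<forall>d. boundary rees f d = 0) \<longleftrightarrow> (\<forall>w\<in>W. \<forall>k<n. (\<Sum>v\<in>fibre {k} w. f (chain v)) = 0)"
    if f: "{c. f c \<noteq> 0} \<subseteq> chain ` W"
  proof
    assume "\<forall>d. boundary rees f d = 0"
    then show "\<forall>w\<in>W. \<forall>k<n. (\<Sum>v\<in>fibre {k} w. f (chain v)) = 0"
      using boundary_facet[OF f] by force
  next
    assume *: "\<forall>w\<in>W. \<forall>k<n. (\<Sum>v\<in>fibre {k} w. f (chain v)) = 0"
    show "\<forall>d. boundary rees f d = 0"
    proof
      fix d
      show "boundary rees f d = 0"
      proof (cases "\<exists>w\<in>W. \<exists>k<n. d = facet w k")
        case True
        then show ?thesis using boundary_facet[OF f] * by force
      next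
        case False
        then have "(\<Sum>k | k < n \<and> facet w k = d. (-1) ^ k * f (chain w)) = 0" if "w \<in> W" for w
          using \<open>w \<in> W\<close> by (intro sum.neutral) auto
        then show ?thesis by (simp add: boundary_rees[OF f])
      qed
    qed
  qed
  moreover have "finite {c. f c \<noteq> 0}" if "{c. f c \<noteq> 0} \<subseteq> chain ` W"
    using that fin by (rule finite_subset[OF _ finite_imageI])
  ultimately show ?thesis
    unfolding cycles_def chain_space_def by (auto simp: simplices_eq fun_eq_iff)
qed

lemma boundaries_top: "boundaries rees (int n - 1) = {\<lambda>_. 0}"
proof -
  have "{f :: ((real ^ 'n) set \<times> nat) set \<Rightarrow> complex. finite {c. f c \<noteq> 0} \<and> {c. f c \<noteq> 0} \<subseteq> {}} = {\<lambda>_. 0}"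
    by auto
  then show ?thesis
    by (simp add: boundaries_def chain_space_def simplices_top boundary_def)
qed

end

section \<open>Dimension of the homology\<close>

text \<open>The vectors dual to the coordinates form a basis. \<open>ev\<close> is abstract because
  the elements of the homology space are cosets, not functions.\<close>

lemma dim_eq_card_coordinates:
  fixes V :: "('k::field, 'v, 'm) module_scheme" and ev :: "'v \<Rightarrow> 'i \<Rightarrow> 'k"
  assumes vs: "vectorspace class_ring V" and D: "finite D"
    and add: "\<And>x y i. x \<in> carrier V \<Longrightarrow> y \<in> carrier V \<Longrightarrow> i \<in> D \<Longrightarrow> ev (x \<oplus>\<^bsub>V\<^esub> y) i = ev x i + ev y i"
    and smult: "\<And>a x i. x \<in> carrier V \<Longrightarrow> i \<in> D \<Longrightarrow> ev (a \<odot>\<^bsub>V\<^esub> x) i = a * ev x i"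
    and inj: "\<And>x y. x \<in> carrier V \<Longrightarrow> y \<in> carrier V \<Longrightarrow> (\<And>i. i \<in> D \<Longrightarrow> ev x i = ev y i) \<Longrightarrow> x = y"
    and surj: "\<And>\<phi>. \<exists>x\<in>carrier V. \<forall>i\<in>D. ev x i = \<phi> i"
  shows "vectorspace.dim class_ring V = card D"
proof -
  interpret V: vectorspace class_ring V by (rule vs)
  have "\<forall>i. \<exists>x\<in>carrier V. \<forall>j\<in>D. ev x j = (if j = i then 1 else 0)"
    by (intro allI surj)
  then obtain b where b: "\<And>i. b i \<in> carrier V" "\<And>i j. j \<in> D \<Longrightarrow> ev (b i) j = (if j = i then 1 else 0)"
    by metis
  have inj_b: "inj_on b D"
    by (rule inj_onI) (metis b(2) zero_neq_one)
  have zero: "ev \<zero>\<^bsub>V\<^esub> i = 0" if "i \<in> D" for i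
    using smult[of "\<zero>\<^bsub>V\<^esub>" i 0] that V.smult_r_null[of 0] by simp
  have lin: "ev (V.lincomb a A) i = (\<Sum>v\<in>A. a v * ev v i)" if "finite A" "A \<subseteq> carrier V" "i \<in> D" for a A i
    using that
  proof (induction A rule: finite_induct)
    case empty
    then show ?case by (simp add: V.lincomb_def zero)
  next
    case (insert v A)
    have "V.lincomb a (insert v A) = a v \<odot>\<^bsub>V\<^esub> v \<oplus>\<^bsub>V\<^esub> V.lincomb a A"
      unfolding V.lincomb_def using insert by (subst V.finsum_insert) auto
    moreover have "V.lincomb a A \<in> carrier V"
      using insert by (intro V.lincomb_closed) auto
    ultimately show ?case using insert add smult by simp
  qed
  let ?A = "b ` D"
  have A: "finite ?A" "?A \<subseteq> carrier V" using D b by auto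
  have coord: "ev (V.lincomb a ?A) i = a (b i)" if "i \<in> D" for a i
  proof -
    have "ev (V.lincomb a ?A) i = (\<Sum>j\<in>D. a (b j) * ev (b j) i)"
      using lin[OF A that] by (simp add: sum.reindex[OF inj_b])
    also have "\<dots> = (\<Sum>j\<in>D. if i = j then a (b j) else 0)"
      by (rule sum.cong) (use b(2) \<open>i \<in> D\<close> in auto)
    finally show ?thesis using D \<open>i \<in> D\<close> by simp
  qed
  have "V.lin_indpt ?A"
  proof (rule V.finite_lin_indpt2[OF A])
    fix a assume "V.lincomb a ?A = \<zero>\<^bsub>V\<^esub>"
    then show "\<forall>v\<in>?A. a v = \<zero>\<^bsub>class_ring\<^esub>" using coord[of _ a] zero by auto
  qed
  moreover have "V.span ?A = carrier V"
  proof
    show "V.span ?A \<subseteq> carrier V" using A(2) by (rule V.span_is_subset2)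
    show "carrier V \<subseteq> V.span ?A"
    proof
      fix x assume x: "x \<in> carrier V"
      \<comment> \<open>\<open>lincomb\<close> takes coefficients indexed by vectors, so each basis
        vector is sent back to its index.\<close>
      define a where "a v = ev x (inv_into D b v)" for v
      have "V.lincomb a ?A \<in> carrier V" using A by (intro V.lincomb_closed) auto
      then have "x = V.lincomb a ?A"
        using x inv_into_f_f[OF inj_b] by (intro inj) (auto simp: coord a_def)
      then show "x \<in> V.span ?A" unfolding V.span_def using A by auto
    qed
  qed
  ultimately have "V.basis ?A" using A by (simp add: V.basis_def)
  then show ?thesis using V.dim_basis[OF A(1)] card_image[OF inj_b] by simp
qed

text \<open>Modulo the zero space every coset is a singleton, so \<open>the_elem\<close> recovers
  the cycle and its values on \<open>D\<close> are coordinates.\<close>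

lemma dim_reduced_homology:
  fixes r :: "'a rel"
  assumes bnd: "boundaries r k = {\<lambda>_. 0}" and D: "finite D"
    and zero: "(\<lambda>_. 0) \<in> cycles r k"
    and add: "\<And>f g. f \<in> cycles r k \<Longrightarrow> g \<in> cycles r k \<Longrightarrow> (\<lambda>c. f c + g c) \<in> cycles r k"
    and smult: "\<And>a f. f \<in> cycles r k \<Longrightarrow> (\<lambda>c. a * f c) \<in> cycles r k"
    and inj: "\<And>f c. f \<in> cycles r k \<Longrightarrow> (\<And>c. c \<in> D \<Longrightarrow> f c = 0) \<Longrightarrow> f c = 0"
    and surj: "\<And>\<phi>. \<exists>f\<in>cycles r k. \<forall>c\<in>D. f c = \<phi> c"
  shows "vectorspace.dim class_ring (reduced_homology r k) = card D"
proof -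
  define V where "V = reduced_homology r k"
  have carrier: "carrier V = (\<lambda>f. {f}) ` cycles r k"
    by (auto simp: V_def reduced_homology_def quotient_space_def bnd A_RCOSETS_def' a_r_coset_def' chain_space_def)
  have V_zero: "\<zero>\<^bsub>V\<^esub> = {\<lambda>_. 0}"
    by (simp add: V_def reduced_homology_def quotient_space_def bnd)
  have V_add: "{f} \<oplus>\<^bsub>V\<^esub> {g} = {\<lambda>c. f c + g c}" for f g
    by (simp add: V_def reduced_homology_def quotient_space_def set_add_def' chain_space_def)
  have V_smult: "a \<odot>\<^bsub>V\<^esub> {f} = {\<lambda>c. a * f c}" for a f
    by (simp add: V_def reduced_homology_def quotient_space_def bnd a_r_coset_def' chain_space_def)
  have "abelian_group V"
  proof (rule abelian_groupI)
    show "\<exists>y\<in>carrier V. y \<oplus>\<^bsub>V\<^esub> x = \<zero>\<^bsub>V\<^esub>" if "x \<in> carrier V" for x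
    proof -
      obtain f where f: "f \<in> cycles r k" "x = {f}" using \<open>x \<in> carrier V\<close> carrier by auto
      then have "{\<lambda>c. - 1 * f c} \<in> carrier V" using smult carrier by blast
      moreover have "{\<lambda>c. - 1 * f c} \<oplus>\<^bsub>V\<^esub> x = \<zero>\<^bsub>V\<^esub>" by (simp add: f V_add V_zero)
      ultimately show ?thesis by blast
    qed
  qed (use add zero in \<open>auto simp: carrier V_zero V_add ac_simps\<close>)
  then have "module class_ring V"
    by (rule moduleI[OF class_cring.is_cring])
      (use smult in \<open>auto simp: carrier V_add V_smult algebra_simps\<close>)
  then have vs: "vectorspace class_ring V"
    by (intro vectorspace.intro class_field)
  have "vectorspace.dim class_ring V = card D"
  proof (rule dim_eq_card_coordinates[OF vs D, where ev = the_elem])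
    fix x y assume xy: "x \<in> carrier V" "y \<in> carrier V" and eq: "\<And>c. c \<in> D \<Longrightarrow> the_elem x c = the_elem y c"
    obtain f g where fg: "f \<in> cycles r k" "x = {f}" "g \<in> cycles r k" "y = {g}" using xy carrier by auto
    have "(\<lambda>c. f c + (-1) * g c) \<in> cycles r k" using add smult fg by blast
    from inj[OF this] have "f c = g c" for c using eq fg by simp
    then show "x = y" using fg by auto
  next
    show "\<exists>x\<in>carrier V. \<forall>i\<in>D. the_elem x i = \<phi> i" for \<phi>
      using surj[of \<phi>] by (auto simp: carrier)
  qed (auto simp: carrier V_add V_smult)
  then show ?thesis by (simp add: V_def)
qed

context vertex_labelling
begin

lemma dim_homology: "vectorspace.dim class_ring (reduced_homology rees (int n - 1)) = card (desc_words {1..int n})"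
proof -
  have desc: "desc = desc_words {1..int n}" by (simp add: desc_def desc_words_def)
  have "desc \<subseteq> W" by (auto simp: desc_def)
  have "vectorspace.dim class_ring (reduced_homology rees (int n - 1)) = card (chain ` desc)"
  proof (rule dim_reduced_homology[OF boundaries_top])
    show "finite (chain ` desc)" using \<open>desc \<subseteq> W\<close> fin finite_subset by blast
    show "(\<lambda>_. 0) \<in> cycles rees (int n - 1)" by (simp add: cycles_iff)
    show "(\<lambda>c. f c + g c) \<in> cycles rees (int n - 1)"
      if "f \<in> cycles rees (int n - 1)" "g \<in> cycles rees (int n - 1)" for f g
    proof -
      have "{c. f c + g c \<noteq> 0} \<subseteq> {c. f c \<noteq> 0} \<union> {c. g c \<noteq> 0}" by auto
      also have "\<dots> \<subseteq> chain ` W" using that unfolding cycles_iff by blast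
      finally show ?thesis using that unfolding cycles_iff by (simp add: sum.distrib)
    qed
    show "(\<lambda>c. a * f c) \<in> cycles rees (int n - 1)" if "f \<in> cycles rees (int n - 1)" for a f
      using that unfolding cycles_iff by (auto simp flip: sum_distrib_left)
  next
    fix f c assume f: "f \<in> cycles rees (int n - 1)" and zero: "\<And>c. c \<in> chain ` desc \<Longrightarrow> f c = 0"
    show "f c = 0"
    proof (cases "c \<in> chain ` W")
      case True
      then obtain w where w: "w \<in> W" "c = chain w" by blast
      have "f (chain w) = 0"
        by (rule cycle_unique[where f = "\<lambda>w. f (chain w)"]) (use f zero w cycles_iff in auto)
      then show ?thesis using w by simp
    next
      case False
      then show ?thesis using f unfolding cycles_iff by blast
    qed
  next
    fix \<phi> :: "((real ^ 'n) set \<times> nat) set \<Rightarrow> complex"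
    obtain g where g: "\<And>w. w \<in> desc \<Longrightarrow> g w = \<phi> (chain w)"
      "\<And>w k. w \<in> W \<Longrightarrow> k < n \<Longrightarrow> sum g (fibre {k} w) = 0"
      using cycle_exists[of "\<lambda>w. \<phi> (chain w)"] by metis
    \<comment> \<open>Carries \<open>g\<close> from words to their chains; the value 0 elsewhere
      keeps the support within the simplices.\<close>
    define f where "f c = (if c \<in> chain ` W then g (the_inv_into W chain c) else 0)" for c
    have f: "f (chain w) = g w" if "w \<in> W" for w
      using the_inv_into_f_f[OF inj_chain that] that by (simp add: f_def)
    have "(\<Sum>v\<in>fibre {k} w. f (chain v)) = 0" if "w \<in> W" "k < n" for w k
    proof -
      have "(\<Sum>v\<in>fibre {k} w. f (chain v)) = sum g (fibre {k} w)"
        by (rule sum.cong[OF refl]) (use f fibre_subset in blast)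
      then show ?thesis using g(2)[OF that] by simp
    qed
    moreover have "{c. f c \<noteq> 0} \<subseteq> chain ` W" by (auto simp: f_def)
    ultimately have "f \<in> cycles rees (int n - 1)" by (simp add: cycles_iff)
    moreover have "\<forall>c\<in>chain ` desc. f c = \<phi> c" using f g(1) \<open>desc \<subseteq> W\<close> by auto
    ultimately show "\<exists>f\<in>cycles rees (int n - 1). \<forall>c\<in>chain ` desc. f c = \<phi> c" by blast
  qed
  also have "\<dots> = card desc" by (rule card_image[OF inj_on_subset[OF inj_chain \<open>desc \<subseteq> W\<close>]])
  finally show ?thesis by (simp add: desc)
qed

end

section \<open>Signed permutations that fix no vertex\<close>

definition signed_permutation :: "('n \<Rightarrow> 'n) \<times> ('n \<Rightarrow> real) \<Rightarrow> real ^ 'n \<Rightarrow> real ^ 'n" where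
  "signed_permutation = (\<lambda>(p, s) x. \<chi> i. s i * x $ p i)"

lemma signed_permutation_axis:
  "signed_permutation (p, s) (axis j a) $ i = (if p i = j then s i * a else 0)"
  by (simp add: signed_permutation_def axis_def)

lemma signed_permutation_fixes_vertex_iff:
  fixes p :: "'n::finite \<Rightarrow> 'n"
  assumes "p permutes UNIV"
  shows "(\<exists>v\<in>cross_vertices. signed_permutation (p, s) v = v) \<longleftrightarrow> (\<exists>i. p i = i \<and> s i = 1)"
proof
  assume "\<exists>v\<in>cross_vertices. signed_permutation (p, s) v = v"
  then obtain i and a :: real where a: "a \<noteq> 0" "signed_permutation (p, s) (axis i a) = axis i a"
  proof -
    assume *: "\<And>a i. a \<noteq> 0 \<Longrightarrow> signed_permutation (p, s) (axis i a) = axis i a \<Longrightarrow> thesis"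
    \<comment> \<open>Treats both signs of a vertex uniformly as nonzero multiples of an
      axis.\<close>
    have "- axis i (1 :: real) = axis i (-1)" for i :: 'n 
      by (rule Finite_Cartesian_Product.vec_eq_iff[THEN iffD2]) (simp add: axis_def)
    then show thesis using \<open>\<exists>v\<in>cross_vertices. _\<close> *[of 1] *[of "-1"] by (auto simp: cross_vertices_def)
  qed
  then have "(if p i = i then s i * a else 0) = a"
    using signed_permutation_axis[of p s i a i] by simp
  then show "\<exists>i. p i = i \<and> s i = 1" using a by (intro exI[of _ i]) (auto split: if_splits)
next
  assume "\<exists>i. p i = i \<and> s i = 1"
  then obtain i where i: "p i = i" "s i = 1" by blast
  have pk: "p k = i \<longleftrightarrow> k = i" for k using permutes_inj[OF assms] i by (metis injD)
  then have "signed_permutation (p, s) (axis i 1) = axis i 1"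
    unfolding Finite_Cartesian_Product.vec_eq_iff signed_permutation_axis
    using i by (simp add: pk axis_def)
  then show "\<exists>v\<in>cross_vertices. signed_permutation (p, s) v = v"
    by (intro bexI[of _ "axis i 1"]) (auto simp: cross_vertices_def)
qed

lemma card_BC_derangements:
  "card (BC_derangements :: (real ^ 'n \<Rightarrow> real ^ 'n) set) = card (signed_derangements (UNIV :: 'n::finite set))"
proof -
  have "(BC_derangements :: (real ^ 'n \<Rightarrow> real ^ 'n) set) = signed_permutation ` signed_derangements (UNIV :: 'n set)"
  proof -
    let ?X = "{(p, s :: 'n \<Rightarrow> real). p permutes UNIV \<and> (\<forall>i. s i \<in> {1, -1})}"
    have "hyperoctahedral_group = signed_permutation ` ?X"
      by (auto simp: hyperoctahedral_group_def signed_permutation_def)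
    then have "BC_derangements = {g \<in> signed_permutation ` ?X. \<forall>v\<in>cross_vertices. g v \<noteq> v}"
      by (simp add: BC_derangements_def extreme_point_of_cross_polytope_iff Ball_def)
    also have "\<dots> = signed_permutation ` {x \<in> ?X. \<forall>v\<in>cross_vertices. signed_permutation x v \<noteq> v}"
      by (rule Compr_image_eq)
    also have "{x \<in> ?X. \<forall>v\<in>cross_vertices. signed_permutation x v \<noteq> v} = signed_derangements UNIV"
    proof (rule Set.set_eqI)
      fix x :: "('n \<Rightarrow> 'n) \<times> ('n \<Rightarrow> real)"
      obtain p s where x: "x = (p, s)" by fastforce
      show "x \<in> {x \<in> ?X. \<forall>v\<in>cross_vertices. signed_permutation x v \<noteq> v} \<longleftrightarrow> x \<in> signed_derangements UNIV"
        using signed_permutation_fixes_vertex_iff[of p s] by (auto simp: x signed_derangements_def)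
    qed
    finally show ?thesis .
  qed
  moreover have "inj_on signed_permutation (signed_derangements (UNIV :: 'n set))"
  proof (rule inj_onI, clarify)
    fix p p' :: "'n \<Rightarrow> 'n" and s s' :: "'n \<Rightarrow> real"
    assume ps: "(p, s) \<in> signed_derangements UNIV" "(p', s') \<in> signed_derangements UNIV"
      and eq: "signed_permutation (p, s) = signed_permutation (p', s')"
    have "p i = p' i \<and> s i = s' i" for i
    proof -
      have "s i = 1 \<or> s i = -1" using ps(1) by (auto simp: signed_derangements_def)
      then have "s i \<noteq> 0" by auto
      \<comment> \<open>Compares coordinate \<open>i\<close> of the images of axis
        \<open>p i\<close>; as \<open>s i\<close> is nonzero, \<open>p'\<close> must agree with
        \<open>p\<close> there.\<close>
      moreover have "s i = (if p' i = p i then s' i else 0)"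
        using signed_permutation_axis[of p s "p i" 1 i] signed_permutation_axis[of p' s' "p i" 1 i] eq
        by (auto split: if_splits)
      ultimately show ?thesis by (auto split: if_splits)
    qed
    then show "p = p' \<and> s = s'" by auto
  qed
  then have "card (signed_permutation ` signed_derangements (UNIV :: 'n set)) = card (signed_derangements (UNIV :: 'n set))"
    by (rule card_image)
  ultimately show ?thesis by simp
qed

theorem theorem6p2:
  "vectorspace.dim class_ring
     (reduced_homology
       (rees_product (PCP_minus :: (real ^ 'n) set rel) (chain_poset CARD('n)))
       (int CARD('n) - 1))
   = card (BC_derangements :: (real ^ 'n \<Rightarrow> real ^ 'n) set)"
proof -
  obtain e :: "int \<Rightarrow> 'n" where "bij_betw e {1..int CARD('n)} UNIV"
    using finite_same_card_bij[of "{1..int CARD('n)}" "UNIV :: 'n set"] by auto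
  then interpret vertex_labelling e "CARD('n)" by unfold_locales auto
  have "card (desc_words {1..int CARD('n)}) = card (signed_derangements (UNIV :: 'n set))"
    by (rule card_desc_words) auto
  then show ?thesis using dim_homology by (simp add: rees_def card_BC_derangements)
qed

end
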